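(* Let $K$ be a compact convex set with nonempty interior in $\mathbb{H}^2$ (curvature $-1$), and let $O\in\mathbb{H}^2$. Represent $\mathbb{H}^2$ by the Beltrami–Klein model with $O$ at the center, and for each $\varphi$ let $\lambda_1(\varphi)$ be the right-hand support line of $K$ through the ideal point $R(\varphi)$ and $r(\varphi)$ the signed hyperbolic distance from $O$ to $\lambda_1(\varphi)$. Then $$\mathcal{P}=\int_0^{2\pi}\sinh r(\varphi)\,d\varphi .$$
   Context: Beltrami–Klein model: open unit disk $D$ with the Hilbert metric $h(P,Q)=\frac12\log\!\left(\frac{|AQ|}{|AP|}\frac{|BP|}{|BQ|}\right)$, $A,B$ the points where the Euclidean line $PQ$ meets the unit circle, in order $A,P,Q,B$. $R(\varphi)=(\cos\varphi,\sin\varphi)$, $e(\varphi)=(-\sin\varphi,\cos\varphi)$; for $X\in D$, $\psi_X(\varphi)\in(0,\pi)$ is the counterclockwise angle from $e(\varphi)$ to $X-R(\varphi)$, and $\psi_1(\varphi)=\min_{X\in K}\psi_X(\varphi)$. The right-hand support line $\lambda_1(\varphi)$ is the line through $R(\varphi)$ at counterclockwise angle $\psi_1(\varphi)$ from $e(\varphi)$. The sign of $r(\varphi)$ is positive if $O$ lies in the open half-plane bounded by $\lambda_1(\varphi)$ that contains the interior of $K$, negative if $O$ lies in the other open half-plane, and $r=0$ if $O\in\lambda_1(\varphi)$. $\mathcal{P}$ is the hyperbolic length of $\partial K$. *)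

theory Defs
  imports "HOL-Analysis.Analysis"
begin

text \<open>Beltrami-Klein model: the open unit disk of the complex plane (identified with R^2),
  with the base point O at the centre 0.\<close>

definition kdisk :: "complex set" where
  "kdisk = ball 0 1"

text \<open>Hilbert metric h(P,Q) = 1/2 log(|AQ||BP| / (|AP||BQ|)), with A, P, Q, B in this order
  on the Euclidean line PQ and A, B on the unit circle.\<close>
definition hdist :: "complex \<Rightarrow> complex \<Rightarrow> real" where
  "hdist P Q =
     (if P = Q then 0 else
      (let A = (THE A. \<exists>s<0. A = P + of_real s * (Q - P) \<and> cmod A = 1);
           B = (THE B. \<exists>s>1. B = P + of_real s * (Q - P) \<and> cmod B = 1)
       in (1/2) * ln ((cmod (Q - A) * cmod (P - B)) / (cmod (P - A) * cmod (Q - B)))))"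

definition Rpt :: "real \<Rightarrow> complex" where
  "Rpt \<phi> = cis \<phi>"

definition evec :: "real \<Rightarrow> complex" where
  "evec \<phi> = \<i> * cis \<phi>"

definition psiX :: "complex \<Rightarrow> real \<Rightarrow> real" where
  "psiX X \<phi> = Arg ((X - Rpt \<phi>) / evec \<phi>)"

definition psi1 :: "complex set \<Rightarrow> real \<Rightarrow> real" where
  "psi1 K \<phi> = (INF X\<in>K. psiX X \<phi>)"

definition ldir :: "complex set \<Rightarrow> real \<Rightarrow> complex" where
  "ldir K \<phi> = evec \<phi> * cis (psi1 K \<phi>)"

definition lambda1 :: "complex set \<Rightarrow> real \<Rightarrow> complex set" where
  "lambda1 K \<phi> = {Rpt \<phi> + of_real t * ldir K \<phi> | t. True}"

definition hp_left :: "complex set \<Rightarrow> real \<Rightarrow> complex set" where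
  "hp_left K \<phi> = {Z. Im (cnj (ldir K \<phi>) * (Z - Rpt \<phi>)) > 0}"

definition hp_right :: "complex set \<Rightarrow> real \<Rightarrow> complex set" where
  "hp_right K \<phi> = {Z. Im (cnj (ldir K \<phi>) * (Z - Rpt \<phi>)) < 0}"

definition dist_line :: "complex set \<Rightarrow> real \<Rightarrow> real" where
  "dist_line K \<phi> = (INF Y\<in>lambda1 K \<phi> \<inter> kdisk. hdist 0 Y)"

definition rsig :: "complex set \<Rightarrow> real \<Rightarrow> real" where
  "rsig K \<phi> =
     (if 0 \<in> lambda1 K \<phi> then 0
      else if (interior K \<subseteq> hp_left K \<phi> \<and> 0 \<in> hp_left K \<phi>) \<or>
              (interior K \<subseteq> hp_right K \<phi> \<and> 0 \<in> hp_right K \<phi>)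
      then dist_line K \<phi> else - dist_line K \<phi>)"

definition hyp_length :: "(real \<Rightarrow> complex) \<Rightarrow> ereal" where
  "hyp_length \<gamma> = Sup {ereal (\<Sum>i<n. hdist (\<gamma> (t i)) (\<gamma> (t (Suc i)))) | t n.
       t 0 = 0 \<and> t n = 1 \<and> (\<forall>i<n. t i \<le> t (Suc i))}"

end

theory Submission
  imports Defs
begin

text \<open>
  Writing \<open>w = X / R(\<phi>)\<close>, the cotangent of the angle \<open>\<psi>\<^sub>X(\<phi>)\<close> is
  \<open>Im w / (1 - Re w) = - d/d\<phi> ln (1 - Re w)\<close>, and \<open>sinh r(\<phi>) = cot \<psi>\<^sub>1(\<phi>)\<close> is its
  maximum \<open>M(\<phi>)\<close> over \<open>K\<close>.  For two points \<open>P\<close>, \<open>Q\<close> the difference of their cotangents changes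
  sign exactly at the two ideal points of the line \<open>PQ\<close>, so the primitive gives the Crofton formula
  \<open>4 h(P,Q) = \<integral> |cot \<psi>\<^sub>Q - cot \<psi>\<^sub>P| d\<phi>\<close>.  A line through \<open>R(\<phi>)\<close> that meets the interior of \<open>K\<close> crosses
  the boundary at most twice, so the cotangent has total variation \<open>2 (M(\<phi>) - m(\<phi>))\<close> along
  the boundary, \<open>m\<close> being the minimum; hence the length is \<open>\<integral> (M - m) / 2\<close>.  Finally
  \<open>d\<phi> du\<close> (\<open>u\<close> the cotangent) is invariant under reversing the orientation of lines, which
  gives \<open>\<integral> m = - \<integral> M\<close>.
\<close>

section \<open>Busemann cotangents\<close>

definition kcot :: "complex \<Rightarrow> real \<Rightarrow> real" where
  "kcot X \<phi> = Im (cis (- \<phi>) * X) / (1 - Re (cis (- \<phi>) * X))"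

lemma Re_cis_mult_less_1: "cmod X < 1 \<Longrightarrow> Re (cis a * X) < 1"
  using complex_Re_le_cmod[of "cis a * X"] by (simp add: norm_mult)

lemma kcot_periodic: "kcot X (\<phi> + 2 * pi) = kcot X \<phi>"
  by (simp add: kcot_def cos_diff sin_diff cis.ctr)

lemma cmod_cis_diff_le: "cmod (cis a - cis b) \<le> \<bar>a - b\<bar>"
proof -
  have "cis a - cis b = cis b * (cis (a - b) - 1)"
    by (simp add: right_diff_distrib cis_mult)
  then have "cmod (cis a - cis b) = cmod (exp (\<i> * of_real (a - b)) - 1)"
    by (simp add: norm_mult cis_conv_exp)
  also have "\<dots> = 2 * \<bar>sin ((a - b) / 2)\<bar>"
    using dist_exp_i_1[of "a - b"] by simp
  also have "\<dots> \<le> \<bar>a - b\<bar>"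
    using abs_sin_x_le_abs_x[of "(a - b) / 2"] by simp
  finally show ?thesis .
qed

text \<open>On the closed disk of radius \<open>r < 1\<close> the denominator stays away from 0, so
  the quotient is uniformly continuous there. Rotation maps this disk to itself and is Lipschitz
  with constant 1 in the point and in the angle. Joint uniformity serves both the continuity of the
  extremes in \<phi> and the approximation of boundary points by vertices.\<close>

lemma kcot_uniformly_continuous:
  assumes "r < 1" "0 < e"
  obtains d where "0 < d" "\<And>X Y \<phi> \<theta>. cmod X \<le> r \<Longrightarrow> cmod Y \<le> r \<Longrightarrow> dist X Y < d \<Longrightarrow>
    \<bar>\<phi> - \<theta>\<bar> < d \<Longrightarrow> \<bar>kcot X \<phi> - kcot Y \<theta>\<bar> < e"
proof -
  let ?q = "\<lambda>w. Im w / (1 - Re w)"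
  have ne: "1 - Re w \<noteq> 0" if "w \<in> cball 0 r" for w
    using that complex_Re_le_cmod[of w] assms by auto
  have "uniformly_continuous_on (cball 0 r) ?q"
    by (rule compact_uniformly_continuous) (use ne in \<open>auto intro!: continuous_intros\<close>)
  then obtain d where d: "d > 0" "\<And>w w'. w \<in> cball 0 r \<Longrightarrow> w' \<in> cball 0 r \<Longrightarrow> dist w' w < d
     \<Longrightarrow> dist (?q w') (?q w) < e"
    unfolding uniformly_continuous_on_def using \<open>0 < e\<close> by metis
  show thesis
  proof
    show "d / 2 > 0" using d by simp
    fix X Y \<phi> \<theta> assume *: "cmod X \<le> r" "cmod Y \<le> r" "dist X Y < d/2" "\<bar>\<phi> - \<theta>\<bar> < d/2"
    have "cis (- \<phi>) * X - cis (- \<theta>) * Y = cis (- \<phi>) * (X - Y) + (cis (- \<phi>) - cis (- \<theta>)) * Y"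
      by (simp add: algebra_simps)
    then have "dist (cis (- \<phi>) * X) (cis (- \<theta>) * Y)
        \<le> cmod (cis (- \<phi>) * (X - Y)) + cmod ((cis (- \<phi>) - cis (- \<theta>)) * Y)"
      unfolding dist_norm by (metis norm_triangle_ineq)
    also have "\<dots> = dist X Y + cmod (cis (- \<phi>) - cis (- \<theta>)) * cmod Y"
      by (simp add: norm_mult dist_norm)
    also have "\<dots> \<le> dist X Y + cmod (cis (- \<phi>) - cis (- \<theta>)) * 1"
      using *(2) assms(1) by (intro add_left_mono mult_left_mono) auto
    also have "\<dots> \<le> dist X Y + \<bar>\<phi> - \<theta>\<bar>"
      using cmod_cis_diff_le[of "- \<phi>" "- \<theta>"] by simp
    also have "\<dots> < d" using * by simp
    finally have "dist (cis (- \<phi>) * X) (cis (- \<theta>) * Y) < d" .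
    then have "dist (?q (cis (- \<phi>) * X)) (?q (cis (- \<theta>) * Y)) < e"
      by (intro d) (use * in \<open>auto simp: norm_mult\<close>)
    then show "\<bar>kcot X \<phi> - kcot Y \<theta>\<bar> < e"
      by (simp add: kcot_def dist_real_def)
  qed
qed

lemma DERIV_kcot_primitive:
  assumes "cmod X < 1"
  shows "((\<lambda>\<phi>. ln (1 - Re (cis (- \<phi>) * X))) has_real_derivative - kcot X \<phi>) (at \<phi>)"
  using Re_cis_mult_less_1[OF assms, of "- \<phi>"]
  by (auto intro!: derivative_eq_intros simp: kcot_def field_simps)

section \<open>The Hilbert metric as an integral\<close>

text \<open>Makes the \<open>THE\<close> in \<open>hdist\<close> meaningful. Existence is the
  intermediate value theorem along the ray from \<open>Q\<close>; uniqueness holds because a point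
  strictly between \<open>Q\<close>, which is inside the disk, and a point of the circle is itself
  inside.\<close>

lemma chord_end_ex1:
  assumes "cmod P < 1" "cmod Q < 1" "P \<noteq> Q"
  shows "\<exists>!B. \<exists>s>1. B = P + of_real s * (Q - P) \<and> cmod B = 1"
proof -
  let ?X = "\<lambda>s. P + of_real s * (Q - P)"
  have pos: "cmod (Q - P) > 0" using assms by simp
  \<comment> \<open>Chosen so that \<open>S * cmod (Q - P) = cmod (Q - P) + 2\<close>; since
    \<open>cmod P < 1\<close>, the point with parameter \<open>S\<close> then lies outside the open
    disk.\<close>
  define S where "S = 1 + 2 / cmod (Q - P)"
  have "S \<ge> 1" using pos by (simp add: S_def)
  have "S * cmod (Q - P) = cmod (Q - P) + 2" using pos by (simp add: S_def field_simps)
  moreover have "cmod (of_real S * (Q - P)) = S * cmod (Q - P)"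
    using \<open>S \<ge> 1\<close> by (simp add: norm_mult)
  moreover have "cmod (of_real S * (Q - P)) \<le> cmod (?X S) + cmod P"
    using norm_triangle_ineq4[of "?X S" P] by simp
  ultimately have "cmod (?X S) \<ge> 1" using assms(1) pos by linarith
  moreover have "cmod (?X 1) \<le> 1" using assms by simp
  moreover have "continuous_on {1..S} (\<lambda>s. cmod (?X s))" by (intro continuous_intros)
  moreover note \<open>S \<ge> 1\<close>
  ultimately obtain s where s: "1 \<le> s" "s \<le> S" "cmod (?X s) = 1"
    using IVT'[of "\<lambda>s. cmod (?X s)" 1 1 S] by auto
  with assms have "s \<noteq> 1" by auto
  with s have s1: "s > 1" by simp
  have no: False if "1 < s" "s < t" "cmod (?X s) = 1" "cmod (?X t) = 1" for s t
  proof -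
    \<comment> \<open>The weight that writes the point at \<open>s\<close> as a convex combination
      of \<open>Q\<close> (parameter 1) and the point at \<open>t\<close>.\<close>
    define l where "l = (s - 1) / (t - 1)"
    have "l * (t - 1) = s - 1" using that by (simp add: l_def)
    then have l: "0 < l" "l < 1" "s = 1 - l + l * t"
      using that by (simp_all add: l_def[symmetric] right_diff_distrib) (simp_all add: l_def)
    then have l': "0 < 1 - l" by simp
    have "?X s = of_real (1 - l) * Q + of_real l * ?X t"
      unfolding l(3) by (simp add: algebra_simps)
    then have "cmod (?X s) \<le> (1 - l) * cmod Q + l * cmod (?X t)"
      using norm_triangle_ineq[of "of_real (1 - l) * Q" "of_real l * ?X t"] l
      by (simp add: norm_mult del: of_real_diff)
    also have "\<dots> < 1" 
      using mult_strict_left_mono[OF assms(2) l'] unfolding that(4) mult_1_right by linarith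
    finally show False using that by simp
  qed
  show ?thesis
  proof (rule ex1I[of _ "?X s"])
    show "\<exists>s'>1. ?X s = ?X s' \<and> cmod (?X s) = 1" using s s1 by blast
    fix B assume "\<exists>s>1. B = ?X s \<and> cmod B = 1"
    then obtain t where t: "t > 1" "B = ?X t" "cmod (?X t) = 1" by auto
    then show "B = ?X s" using no[of s t] no[of t s] s1 s(3) by (cases s t rule: linorder_cases) auto
  qed
qed

text \<open>In the affine parameter that is 0 at \<open>A\<close> and 1 at \<open>B\<close>, all
  four distances are multiples of \<open>cmod (B - A)\<close>, which cancels in the
  cross-ratio.\<close>

lemma hdist_chord:
  assumes "cmod P < 1" "cmod Q < 1" "P \<noteq> Q"
  obtains A B p q where "cmod A = 1" "cmod B = 1" "0 < p" "p < q" "q < 1"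
    "P = A + of_real p * (B - A)" "Q = A + of_real q * (B - A)"
    "2 * hdist P Q = ln (q * (1 - p) / (p * (1 - q)))"
proof -
  let ?PA = "\<lambda>A. \<exists>s<0. A = P + of_real s * (Q - P) \<and> cmod A = 1"
  let ?PB = "\<lambda>B. \<exists>s>1. B = P + of_real s * (Q - P) \<and> cmod B = 1"
  \<comment> \<open>Exchanging \<open>P\<close> and \<open>Q\<close> replaces the parameter
    \<open>s\<close> by \<open>1 - s\<close>, so the end behind \<open>P\<close> is covered by the
    lemma on the end beyond \<open>Q\<close>.\<close>
  have "?PA A \<longleftrightarrow> (\<exists>s>1. A = Q + of_real s * (P - Q) \<and> cmod A = 1)" for A
  proof
    assume "?PA A"
    then obtain s where "s < 0" "A = P + of_real s * (Q - P)" "cmod A = 1" by blast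
    then show "\<exists>s>1. A = Q + of_real s * (P - Q) \<and> cmod A = 1"
      by (intro exI[of _ "1 - s"]) (auto simp: algebra_simps)
  next
    assume "\<exists>s>1. A = Q + of_real s * (P - Q) \<and> cmod A = 1"
    then obtain s where "s > 1" "A = Q + of_real s * (P - Q)" "cmod A = 1" by blast
    then show "?PA A"
      by (intro exI[of _ "1 - s"]) (auto simp: algebra_simps)
  qed
  then have exA: "\<exists>!A. ?PA A"
    using chord_end_ex1[OF assms(2,1)] assms(3) by simp
  have exB: "\<exists>!B. ?PB B" by (rule chord_end_ex1[OF assms])
  define A where "A = (THE A. ?PA A)"
  define B where "B = (THE B. ?PB B)"
  have "?PA A" unfolding A_def by (rule theI'[OF exA])
  then obtain s where s: "s < 0" "A = P + of_real s * (Q - P)" "cmod A = 1" by blast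
  have "?PB B" unfolding B_def by (rule theI'[OF exB])
  then obtain t where t: "t > 1" "B = P + of_real t * (Q - P)" "cmod B = 1" by blast
  \<comment> \<open>Affine change of parameter: \<open>P\<close>, \<open>Q\<close>,
    \<open>A\<close>, \<open>B\<close> sit at 0, 1, \<open>s\<close>, \<open>t\<close>, and
    \<open>s\<close>, \<open>t\<close> are sent to 0, 1.\<close>
  define p where "p = - s / (t - s)"
  define q where "q = (1 - s) / (t - s)"
  have ts: "t - s > 0" using s t by simp
  have pq: "0 < p" "p < q" "q < 1"
    using s t by (auto simp: p_def q_def field_simps)
  have pqts: "p * (t - s) = - s" "q * (t - s) = 1 - s"
    using ts by (auto simp: p_def q_def)
  have BA: "B - A = of_real (t - s) * (Q - P)"
    unfolding s t by (simp add: algebra_simps)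
  have P: "P = A + of_real p * (B - A)"
    unfolding BA mult.assoc[symmetric] of_real_mult[symmetric] pqts by (simp add: s(2))
  have Q: "Q = A + of_real q * (B - A)"
    unfolding BA mult.assoc[symmetric] of_real_mult[symmetric] pqts by (simp add: s(2) algebra_simps)
  have ne: "cmod (B - A) > 0" using BA ts assms(3) by simp
  have "Q - A = of_real q * (B - A)" "P - B = of_real (p - 1) * (B - A)"
       "P - A = of_real p * (B - A)" "Q - B = of_real (q - 1) * (B - A)"
    by (subst P Q, simp add: algebra_simps)+
  then have "(cmod (Q - A) * cmod (P - B)) / (cmod (P - A) * cmod (Q - B))
     = (q * (1 - p)) / (p * (1 - q))"
    using pq ne by (simp add: norm_mult del: of_real_diff)
  then have "2 * hdist P Q = ln (q * (1 - p) / (p * (1 - q)))"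
    using assms(3) by (simp add: hdist_def A_def[symmetric] B_def[symmetric])
  then show thesis by (rule that[OF s(3) t(3) pq P Q])
qed

text \<open>The derivative has sign \<sigma> on \<open>{c..d}\<close> and the opposite sign on the
  rest of the interval. Since \<open>D T = D 0\<close>, the change over the rest cancels the change
  over \<open>{c..d}\<close>, so both contribute the same amount to the integral of the absolute
  value.\<close>

lemma has_integral_abs_derivative:
  fixes D g :: "real \<Rightarrow> real"
  assumes "0 \<le> c" "c \<le> d" "d \<le> T" "D T = D 0" "\<bar>\<sigma>\<bar> = 1"
    and der: "\<And>x. (D has_real_derivative g x) (at x)"
    and pos: "\<And>x. c \<le> x \<Longrightarrow> x \<le> d \<Longrightarrow> 0 \<le> \<sigma> * g x"
    and neg: "\<And>x. 0 \<le> x \<Longrightarrow> x \<le> c \<Longrightarrow> \<sigma> * g x \<le> 0" "\<And>x. d \<le> x \<Longrightarrow> x \<le> T \<Longrightarrow> \<sigma> * g x \<le> 0"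
  shows "((\<lambda>x. \<bar>g x\<bar>) has_integral (2 * \<sigma> * (D d - D c))) {0..T}"
proof -
  have *: "((\<lambda>x. \<bar>g x\<bar>) has_integral k * (D v - D u)) {u..v}"
    if "u \<le> v" "\<And>x. x \<in> {u..v} \<Longrightarrow> k * g x = \<bar>g x\<bar>" for u v k
  proof -
    have "((\<lambda>x. k * g x) has_integral k * (D v - D u)) {u..v}"
      using der that(1)
      by (intro has_integral_mult_right fundamental_theorem_of_calculus)
        (auto simp: has_real_derivative_iff_has_vector_derivative[symmetric] intro: DERIV_subset)
    then show ?thesis using that(2) by (rule has_integral_eq[rotated])
  qed
  have sg: "k * y = \<bar>y\<bar>" if "0 \<le> k * y" "\<bar>k\<bar> = 1" for k y :: real
    using that by (metis abs_mult abs_of_nonneg mult_1)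
  have "((\<lambda>x. \<bar>g x\<bar>) has_integral - \<sigma> * (D c - D 0)) {0..c}"
    by (rule *[OF assms(1)], rule sg) (use neg(1) assms(5) in auto)
  moreover have "((\<lambda>x. \<bar>g x\<bar>) has_integral \<sigma> * (D d - D c)) {c..d}"
    by (rule *[OF assms(2)], rule sg) (use pos assms(5) in auto)
  ultimately have "((\<lambda>x. \<bar>g x\<bar>) has_integral - \<sigma> * (D c - D 0) + \<sigma> * (D d - D c)) {0..d}"
    by (rule has_integral_combine[OF assms(1,2)])
  moreover have "((\<lambda>x. \<bar>g x\<bar>) has_integral - \<sigma> * (D T - D d)) {d..T}"
    by (rule *[OF assms(3)], rule sg) (use neg(2) assms(5) in auto)
  ultimately have "((\<lambda>x. \<bar>g x\<bar>) has_integral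
     - \<sigma> * (D c - D 0) + \<sigma> * (D d - D c) + - \<sigma> * (D T - D d)) {0..T}"
    by (rule has_integral_combine[OF order_trans[OF assms(1,2)] assms(3)])
  then show ?thesis using assms(4) by (simp add: algebra_simps)
qed

text \<open>This is the numerator of \<open>kcot Q \<phi> - kcot P \<phi>\<close> over the common
  denominator. The product of half-angle sines makes its sign visible: as \<phi> runs over a period,
  it can change only at the chord ends \<open>a\<close> and \<open>b\<close>.\<close>

lemma kcot_diff_chord:
  assumes "P = cis a + of_real p * (cis b - cis a)" "Q = cis a + of_real q * (cis b - cis a)"
  shows "Im (cis (- \<phi>) * Q) * (1 - Re (cis (- \<phi>) * P)) - Im (cis (- \<phi>) * P) * (1 - Re (cis (- \<phi>) * Q))
    = 4 * (q - p) * (sin ((a - \<phi>) / 2) * sin ((b - \<phi>) / 2) * sin ((a - b) / 2))"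
proof -
  define x y where "x = (a - \<phi>) / 2" and "y = (b - \<phi>) / 2"
  have "2 * x = - \<phi> + a" "2 * y = - \<phi> + b" by (simp_all add: x_def y_def)
  then have e: "cis (- \<phi>) * cis a = cis (2 * x)" "cis (- \<phi>) * cis b = cis (2 * y)"
    by (simp_all only: cis_mult)
  have w: "cis (- \<phi>) * (cis a + of_real k * (cis b - cis a))
     = cis (2 * x) + of_real k * (cis (2 * y) - cis (2 * x))" for k
    by (simp only: e[symmetric] distrib_left right_diff_distrib mult.left_commute)
  have s: "(a - b) / 2 = x - y" by (simp add: x_def y_def field_simps)
  have "Im (cis (- \<phi>) * Q) * (1 - Re (cis (- \<phi>) * P)) - Im (cis (- \<phi>) * P) * (1 - Re (cis (- \<phi>) * Q))
    = (q - p) * (sin (2 * y) * (1 - cos (2 * x)) - sin (2 * x) * (1 - cos (2 * y)))"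
    unfolding assms w by (simp add: algebra_simps)
  also have "sin (2 * y) * (1 - cos (2 * x)) - sin (2 * x) * (1 - cos (2 * y))
     = 4 * (sin x * sin y * sin (x - y))"
    unfolding sin_double cos_double_sin sin_diff by (simp add: power2_eq_square algebra_simps)
  finally show ?thesis unfolding s x_def[symmetric] y_def[symmetric] by simp
qed

text \<open>The primitive \<open>D\<close> of the difference of cotangents increases from
  \<open>a\<close> to \<open>b\<close> by the logarithm of the cross-ratio, which is
  \<open>2 * hdist P Q\<close>. The second arc between the chord ends doubles this.\<close>

lemma hdist_integral:
  assumes "cmod P < 1" "cmod Q < 1"
  shows "((\<lambda>\<phi>. \<bar>kcot Q \<phi> - kcot P \<phi>\<bar>) has_integral 4 * hdist P Q) {0..2*pi}"
proof (cases "P = Q")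
  case True
  then show ?thesis by (simp add: hdist_def)
next
  case False
  obtain A B p q where AB: "cmod A = 1" "cmod B = 1" and pq: "0 < p" "p < q" "q < 1"
    and PQ: "P = A + of_real p * (B - A)" "Q = A + of_real q * (B - A)"
    and h: "2 * hdist P Q = ln (q * (1 - p) / (p * (1 - q)))"
    using hdist_chord[OF assms False] by metis
  define a b where "a = Arg2pi A" and "b = Arg2pi B"
  have Aa: "A = cis a" and Bb: "B = cis b"
    using AB by (metis a_def b_def Arg2pi_eq cis_conv_exp mult_1 of_real_1)+
  have ab: "0 \<le> a" "a < 2 * pi" "0 \<le> b" "b < 2 * pi"
    unfolding a_def b_def by (auto simp: Arg2pi)
  have "A \<noteq> B" using PQ False by auto
  then have ne: "a \<noteq> b" using Aa Bb by auto
  define D where "D = (\<lambda>\<phi>. ln (1 - Re (cis (- \<phi>) * P)) - ln (1 - Re (cis (- \<phi>) * Q)))"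
  have der: "(D has_real_derivative kcot Q \<phi> - kcot P \<phi>) (at \<phi>)" for \<phi>
    unfolding D_def
    using DERIV_diff[OF DERIV_kcot_primitive[OF assms(1)] DERIV_kcot_primitive[OF assms(2)], of \<phi>]
    by simp
  have "D (2 * pi) = D 0" by (simp add: D_def cis.ctr)
  \<comment> \<open>At the chord ends, \<open>1 - Re\<close> of the rotated point with parameter
    \<open>u\<close> is \<open>u * k\<close> or \<open>(1 - u) * k\<close>; the common factor
    \<open>k\<close> drops out of the difference of logarithms.\<close>
  define k where "k = 1 - cos (b - a)"
  have "Re (cis (b - a)) \<noteq> 1"
  proof
    assume 1: "Re (cis (b - a)) = 1"
    then have "Im (cis (b - a)) = 0" using sin_cos_squared_add[of "b - a"] by simp
    with 1 have "cis (b - a) = 1" by (simp add: complex_eq_iff)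
    then have "B = A" unfolding Aa Bb using cis_mult[of a "b - a"] by simp
    with \<open>A \<noteq> B\<close> show False by simp
  qed
  then have k: "k > 0" using cos_le_one[of "b - a"] by (simp add: k_def less_le)
  have Da: "1 - Re (cis (- a) * (cis a + of_real u * (cis b - cis a))) = u * k"
   and Db: "1 - Re (cis (- b) * (cis a + of_real u * (cis b - cis a))) = (1 - u) * k" for u
  proof -
    have "cis (- a) * (cis a + of_real u * (cis b - cis a))
        = cis (- a) * cis a + of_real u * (cis (- a) * cis b - cis (- a) * cis a)"
      by (simp add: algebra_simps)
    also have "\<dots> = 1 + of_real u * (cis (b - a) - 1)"
      by (simp add: cis_mult)
    finally have "cis (- a) * (cis a + of_real u * (cis b - cis a)) = 1 + of_real u * (cis (b - a) - 1)" .
    then show "1 - Re (cis (- a) * (cis a + of_real u * (cis b - cis a))) = u * k"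
      by (simp only:) (simp add: k_def algebra_simps)
    have "cis (- b) * (cis a + of_real u * (cis b - cis a))
        = cis (- b) * cis a + of_real u * (cis (- b) * cis b - cis (- b) * cis a)"
      by (simp add: algebra_simps)
    also have "\<dots> = cis (a - b) + of_real u * (1 - cis (a - b))"
      by (simp add: cis_mult)
    finally have "cis (- b) * (cis a + of_real u * (cis b - cis a)) = cis (a - b) + of_real u * (1 - cis (a - b))" .
    then show "1 - Re (cis (- b) * (cis a + of_real u * (cis b - cis a))) = (1 - u) * k"
      using cos_minus[of "b - a"] by (simp only:) (simp add: k_def algebra_simps)
  qed
  have "D b - D a = ln ((1 - p) * k) - ln ((1 - q) * k) - (ln (p * k) - ln (q * k))"
    unfolding D_def PQ Aa Bb Da Db by simp
  also have "\<dots> = 2 * hdist P Q"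
    unfolding h using pq k by (simp add: ln_mult ln_div)
  finally have Dh: "D b - D a = 2 * hdist P Q" .
  have sgn: "kcot Q \<phi> - kcot P \<phi> = 4 * (q - p) * (sin ((a - \<phi>) / 2) * sin ((b - \<phi>) / 2) * sin ((a - b) / 2))
     / ((1 - Re (cis (- \<phi>) * P)) * (1 - Re (cis (- \<phi>) * Q)))" for \<phi>
    unfolding kcot_diff_chord[OF PQ[unfolded Aa Bb], symmetric] kcot_def
    using Re_cis_mult_less_1[OF assms(1), of "- \<phi>"] Re_cis_mult_less_1[OF assms(2), of "- \<phi>"]
    by (simp add: diff_frac_eq mult.commute)
  have den: "(1 - Re (cis (- \<phi>) * P)) * (1 - Re (cis (- \<phi>) * Q)) > 0" for \<phi>
    using Re_cis_mult_less_1[OF assms(1), of "- \<phi>"] Re_cis_mult_less_1[OF assms(2), of "- \<phi>"] by simp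
  have fac: "4 * (q - p) > 0" using pq by simp
  have sin_pos: "0 \<le> sin (x / 2)" if "0 \<le> x" "x \<le> 2 * pi" for x
    using that by (intro sin_ge_zero) auto
  have sin_neg: "sin (x / 2) \<le> 0" if "x \<le> 0" "- 2 * pi \<le> x" for x
    using sin_pos[of "- x"] that by simp
  have kpos: "kcot P \<phi> \<le> kcot Q \<phi>"
    if "0 \<le> sin ((a - \<phi>) / 2) * sin ((b - \<phi>) / 2) * sin ((a - b) / 2)" for \<phi>
    unfolding diff_ge_0_iff_ge[symmetric, of "kcot P \<phi>"] sgn using that den[of \<phi>]
    by (intro divide_nonneg_pos mult_nonneg_nonneg[OF less_imp_le[OF fac]])
  have kneg: "kcot Q \<phi> \<le> kcot P \<phi>"
    if "sin ((a - \<phi>) / 2) * sin ((b - \<phi>) / 2) * sin ((a - b) / 2) \<le> 0" for \<phi>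
    unfolding diff_le_0_iff_le[symmetric, of "kcot Q \<phi>"] sgn using that den[of \<phi>]
    by (intro divide_nonpos_pos mult_nonneg_nonpos[OF less_imp_le[OF fac]])
  show ?thesis
  \<comment> \<open>The order of \<open>a\<close> and \<open>b\<close> in \<open>{0..2*pi}\<close>
    fixes the sign of \<open>sin ((a - b) / 2)\<close>, and with it whether the difference of
    cotangents is positive or negative between them.\<close>
  proof (cases "a < b")
    case True
    have "((\<lambda>\<phi>. \<bar>kcot Q \<phi> - kcot P \<phi>\<bar>) has_integral 2 * 1 * (D b - D a)) {0..2*pi}"
    proof (rule has_integral_abs_derivative[where D = D and c = a and d = b
        and g = "\<lambda>\<phi>. kcot Q \<phi> - kcot P \<phi>"])
      show "0 \<le> 1 * (kcot Q x - kcot P x)" if "a \<le> x" "x \<le> b" for x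
        using True ab that by (auto intro!: kpos mult_nonpos_nonpos mult_nonpos_nonneg sin_pos sin_neg)
      show "1 * (kcot Q x - kcot P x) \<le> 0" if "0 \<le> x" "x \<le> a" for x
        using True ab that by (auto intro!: kneg mult_nonneg_nonpos mult_nonneg_nonneg sin_pos sin_neg)
      show "1 * (kcot Q x - kcot P x) \<le> 0" if "b \<le> x" "x \<le> 2 * pi" for x
        using True ab that by (auto intro!: kneg mult_nonneg_nonpos mult_nonpos_nonpos sin_pos sin_neg)
    qed (use True ab der \<open>D (2 * pi) = D 0\<close> in auto)
    moreover have "2 * 1 * (D b - D a) = 4 * hdist P Q" using Dh by simp
    ultimately show ?thesis by (simp only:)
  next
    case False
    with ne have "b < a" by simp
    have "((\<lambda>\<phi>. \<bar>kcot Q \<phi> - kcot P \<phi>\<bar>) has_integral 2 * (-1) * (D a - D b)) {0..2*pi}"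
    proof (rule has_integral_abs_derivative[where D = D and c = b and d = a
        and g = "\<lambda>\<phi>. kcot Q \<phi> - kcot P \<phi>"])
      show "0 \<le> (-1) * (kcot Q x - kcot P x)" if "b \<le> x" "x \<le> a" for x
        using \<open>b < a\<close> ab that
        by (auto intro!: kneg mult_nonpos_nonneg[OF mult_nonneg_nonpos] sin_pos sin_neg)
      show "(-1) * (kcot Q x - kcot P x) \<le> 0" if "0 \<le> x" "x \<le> b" for x
        using \<open>b < a\<close> ab that by (auto intro!: kpos mult_nonneg_nonneg sin_pos sin_neg)
      show "(-1) * (kcot Q x - kcot P x) \<le> 0" if "a \<le> x" "x \<le> 2 * pi" for x
        using \<open>b < a\<close> ab that by (auto intro!: kpos mult_nonneg_nonneg[OF mult_nonpos_nonpos] sin_pos sin_neg)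
    qed (use \<open>b < a\<close> ab der \<open>D (2 * pi) = D 0\<close> in auto)
    moreover have "2 * (-1) * (D a - D b) = 4 * hdist P Q" using Dh by simp
    ultimately show ?thesis by (simp only:)
  qed
qed

section \<open>Support lines\<close>

text \<open>Dividing by \<open>evec \<phi>\<close> turns the tangent at \<open>R(\<phi>)\<close>
  into the real axis and the disk into part of the upper half-plane. There \<open>z\<close> has real
  part \<open>Im w\<close> and imaginary part \<open>1 - Re w > 0\<close>, so its argument lies in
  \<open>(0, pi)\<close> and has cotangent \<open>kcot X \<phi>\<close>.\<close>

lemma psiX_polar:
  assumes "cmod X < 1"
  shows "0 < psiX X \<phi>" "psiX X \<phi> < pi" "cot (psiX X \<phi>) = kcot X \<phi>"
    "X - Rpt \<phi> = of_real (cmod (X - Rpt \<phi>)) * (evec \<phi> * cis (psiX X \<phi>))"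
proof -
  define z where "z = (X - Rpt \<phi>) / evec \<phi>"
  define w where "w = cis (- \<phi>) * X"
  have X: "X = cis \<phi> * w" by (simp add: w_def cis_mult flip: mult.assoc)
  have "z = - \<i> * (w - 1)"
    unfolding z_def X by (simp add: Rpt_def evec_def field_simps)
  then have z: "Re z = Im w" "Im z = 1 - Re w" by simp_all
  then have "Im z > 0" using Re_cis_mult_less_1[OF assms, of "- \<phi>"] by (simp add: w_def)
  then show "0 < psiX X \<phi>" "psiX X \<phi> < pi"
    using Arg_lt_pi[of z] by (simp_all add: psiX_def z_def)
  have "z \<noteq> 0" using \<open>Im z > 0\<close> by auto
  then have zp: "z = of_real (cmod z) * cis (psiX X \<phi>)"
    using rcis_cmod_Arg[of z] by (simp add: rcis_def psiX_def z_def)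
  from arg_cong[OF this, of Re] arg_cong[OF this, of Im]
  have "Re z = cmod z * cos (psiX X \<phi>)" "Im z = cmod z * sin (psiX X \<phi>)"
    by (simp_all only: Re_complex_of_real Im_complex_of_real complex_mult_cnj times_complex.sel cis.sel
      mult_zero_left add_0_right diff_0_right)
  with \<open>z \<noteq> 0\<close> show "cot (psiX X \<phi>) = kcot X \<phi>"
    unfolding kcot_def w_def[symmetric] z[symmetric] by (simp add: cot_def)
  have "cmod z = cmod (X - Rpt \<phi>)"
    by (simp add: z_def evec_def norm_divide norm_mult)
  moreover have "X - Rpt \<phi> = z * evec \<phi>" by (simp add: z_def evec_def)
  ultimately show "X - Rpt \<phi> = of_real (cmod (X - Rpt \<phi>)) * (evec \<phi> * cis (psiX X \<phi>))"
    using zp by (metis mult.assoc mult.commute)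
qed

lemma cot_strict_antimono: "0 < x \<Longrightarrow> x < y \<Longrightarrow> y < pi \<Longrightarrow> cot y < cot (x :: real)"
  using sin_gt_zero[of "y - x"] sin_gt_zero[of x] sin_gt_zero[of y]
  by (simp add: cot_def sin_diff field_simps)

lemma continuous_on_kcot_fst:
  assumes "K \<subseteq> kdisk"
  shows "continuous_on K (\<lambda>X. kcot X \<phi>)"
proof -
  have "1 - Re (cis (- \<phi>) * X) \<noteq> 0" if "X \<in> K" for X
    using that assms Re_cis_mult_less_1[of X "- \<phi>"] by (auto simp: kdisk_def)
  then show ?thesis
    unfolding kcot_def by (intro continuous_intros) blast
qed

text \<open>A chord through the centre is a diameter, so the centre has parameter 1/2 and the
  cross-ratio becomes \<open>(1 + cmod Y) / (1 - cmod Y)\<close>.\<close>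

lemma hdist_0:
  assumes "cmod Y < 1"
  shows "hdist 0 Y = artanh (cmod Y)"
proof (cases "Y = 0")
  case True
  then show ?thesis by (simp add: hdist_def artanh_def)
next
  case False
  obtain A B p q where AB: "cmod A = 1" "cmod B = 1" and pq: "0 < p" "p < q" "q < 1"
    and PQ: "0 = A + of_real p * (B - A)" "Y = A + of_real q * (B - A)"
    and h: "2 * hdist 0 Y = ln (q * (1 - p) / (p * (1 - q)))"
    using hdist_chord[of 0 Y] assms False by (metis norm_zero zero_less_one)
  have "of_real (1 - p) * A = - of_real p * B"
    using PQ(1) by (simp add: algebra_simps add_eq_0_iff)
  then have "cmod (of_real (1 - p) * A) = cmod (of_real p * B)" by (simp del: of_real_diff)
  then have p: "p = 1 / 2" using AB pq by (simp add: norm_mult del: of_real_diff)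
  with PQ(1) have "B = - A" by (simp add: field_simps add_eq_0_iff)
  then have "Y = of_real (1 - 2 * q) * A" using PQ(2) by (simp add: algebra_simps)
  then have "cmod Y = 2 * q - 1" using AB p pq by (simp add: norm_mult del: of_real_diff of_real_mult)
  then have q: "q = (1 + cmod Y) / 2" by simp
  have "q * (1 - p) / (p * (1 - q)) = (1 + cmod Y) / (1 - cmod Y)"
    unfolding p q using assms by (simp add: field_simps)
  then show ?thesis using h by (simp add: artanh_def)
qed

text \<open>If \<open>sinh r = \<bar>cot x\<bar>\<close>, then \<open>cosh r = 1 / sin x\<close> and
  hence \<open>tanh r = \<bar>cos x\<bar>\<close>. It converts the Euclidean distance of a support
  line from the centre into \<open>sinh\<close> of the hyperbolic one.\<close>

lemma sinh_artanh_abs_cos: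
  assumes "0 < x" "x < pi"
  shows "sinh (artanh \<bar>cos x\<bar>) = \<bar>cot x\<bar>"
proof -
  have s: "sin x > 0" using assms by (simp add: sin_gt_zero)
  define r where "r = arsinh \<bar>cot x\<bar>"
  have sinh: "sinh r = \<bar>cot x\<bar>" by (simp add: r_def)
  have "(cosh r * sin x)\<^sup>2 = (cos x)\<^sup>2 + (sin x)\<^sup>2"
    using s unfolding power_mult_distrib cosh_square_eq sinh
    by (simp add: cot_def field_simps)
  then have "(cosh r * sin x)\<^sup>2 = 1" by simp
  moreover have "cosh r * sin x > 0" using s cosh_real_pos by simp
  ultimately have "cosh r * sin x = 1" by (auto simp: power2_eq_1_iff)
  then have cosh: "cosh r = 1 / sin x" using s by (simp add: field_simps)
  have "tanh r = \<bar>cos x\<bar>"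
    using s unfolding tanh_def cosh sinh by (simp add: cot_def)
  then have "artanh \<bar>cos x\<bar> = r" using artanh_tanh_real by metis
  then show ?thesis using sinh by simp
qed

text \<open>Cotangent decreases on \<open>(0, pi)\<close>, so the least angle \<psi> belongs to the
  greatest cotangent. The support line has Euclidean distance \<open>\<bar>cos \<psi>\<bar>\<close>
  from the centre, hence hyperbolic distance \<open>artanh \<bar>cos \<psi>\<bar>\<close>, whose
  \<open>sinh\<close> is \<open>\<bar>cot \<psi>\<bar>\<close>. The centre lies on the side of the
  interior of \<open>K\<close> exactly when \<open>cos \<psi> > 0\<close>, which restores the
  sign.\<close>

lemma sinh_rsig:
  assumes "compact K" "interior K \<noteq> {}" "K \<subseteq> kdisk"
  shows "sinh (rsig K \<phi>) = (SUP X\<in>K. kcot X \<phi>)"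
proof -
  have Kne: "K \<noteq> {}" using assms(2) interior_subset by blast
  have lt1: "cmod X < 1" if "X \<in> K" for X using that assms(3) by (auto simp: kdisk_def)
  obtain X0 where X0: "X0 \<in> K" "\<And>X. X \<in> K \<Longrightarrow> kcot X \<phi> \<le> kcot X0 \<phi>"
    using continuous_attains_sup[OF assms(1) Kne continuous_on_kcot_fst[OF assms(3)]] by blast
  define \<psi> where "\<psi> = psi1 K \<phi>"
  have le: "psiX X0 \<phi> \<le> psiX X \<phi>" if "X \<in> K" for X
    using cot_strict_antimono[of "psiX X \<phi>" "psiX X0 \<phi>"] X0 psiX_polar[OF lt1[OF that], of \<phi>]
      psiX_polar[OF lt1[OF X0(1)], of \<phi>] that by fastforce
  then have psi: "\<psi> = psiX X0 \<phi>"
    unfolding \<psi>_def psi1_def using X0(1) by (intro cInf_eq_minimum) auto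
  have sup: "(SUP X\<in>K. kcot X \<phi>) = cot \<psi>"
    unfolding psi psiX_polar(3)[OF lt1[OF X0(1)]] using X0 by (intro cSup_eq_maximum) auto
  have \<psi>: "0 < \<psi>" "\<psi> < pi" using psiX_polar[OF lt1[OF X0(1)]] psi by auto
  then have sinp: "sin \<psi> > 0" by (simp add: sin_gt_zero)
  define l where "l = ldir K \<phi>"
  have l: "l = evec \<phi> * cis \<psi>" by (simp add: l_def ldir_def \<psi>_def)
  have ll: "cnj l * l = 1"
    using complex_norm_square[of l] by (simp add: l evec_def norm_mult mult.commute)
  have side: "Im (cnj l * (X - Rpt \<phi>)) \<ge> 0" if "X \<in> K" for X
  proof -
    have "cnj (evec \<phi>) * evec \<phi> = 1"
      using complex_norm_square[of "evec \<phi>"] by (simp add: evec_def norm_mult mult.commute)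
    then have "cnj l * (X - Rpt \<phi>) = of_real (cmod (X - Rpt \<phi>)) * (cis (- \<psi>) * cis (psiX X \<phi>))"
      by (subst psiX_polar(4)[OF lt1[OF that], of \<phi>]) (simp add: l cis_cnj algebra_simps)
    then have "Im (cnj l * (X - Rpt \<phi>)) = cmod (X - Rpt \<phi>) * sin (psiX X \<phi> - \<psi>)"
      by (simp add: cis_mult)
    moreover have "0 \<le> psiX X \<phi> - \<psi>" "psiX X \<phi> - \<psi> \<le> pi"
      using le[OF that] psi \<psi>(1) psiX_polar(2)[OF lt1[OF that], of \<phi>] by linarith+
    ultimately show ?thesis by (simp add: sin_ge_zero)
  qed
  \<comment> \<open>A shift by \<open>e\<close> against the left normal \<open>\<i> * l\<close>
    stays in \<open>K\<close> and lowers the expression by \<open>e\<close>; by \<open>side\<close>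
    the original value is at least \<open>e\<close>.\<close>
  have int: "Im (cnj l * (Z - Rpt \<phi>)) > 0" if "Z \<in> interior K" for Z
  proof -
    obtain e where e: "e > 0" "cball Z e \<subseteq> K"
      using \<open>Z \<in> interior K\<close> by (auto simp: mem_interior_cball)
    have "cmod l = 1" by (simp add: l evec_def norm_mult)
    then have "Z - of_real e * (\<i> * l) \<in> K"
      using e by (intro subsetD[OF e(2)]) (simp add: dist_norm norm_mult)
    moreover have "cnj l * (Z - of_real e * (\<i> * l) - Rpt \<phi>)
        = cnj l * (Z - Rpt \<phi>) - of_real e * \<i> * (cnj l * l)"
      by (simp only: right_diff_distrib mult_ac) simp
    ultimately have "Im (cnj l * (Z - Rpt \<phi>) - of_real e * \<i> * (cnj l * l)) \<ge> 0"
      using side by metis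
    then show ?thesis using e(1) unfolding ll by simp
  qed
  have "cnj l * (0 - Rpt \<phi>) = \<i> * cis (- \<psi>)"
    by (simp add: l evec_def Rpt_def cis_cnj cis_mult mult.commute mult.left_commute)
  then have O: "Im (cnj l * (0 - Rpt \<phi>)) = cos \<psi>" by simp
  \<comment> \<open>The foot of the Euclidean perpendicular from the centre, where the infimum in
    \<open>dist_line\<close> is attained.\<close>
  define Y0 where "Y0 = Rpt \<phi> + of_real (sin \<psi>) * l"
  have Y0l: "Y0 \<in> lambda1 K \<phi>" by (auto simp: Y0_def lambda1_def l_def)
  have "Y0 = of_real (cos \<psi>) * (cis \<phi> * cis \<psi>)"
  proof -
    have "1 + of_real (sin \<psi>) * (\<i> * cis \<psi>) = of_real (cos \<psi>) * cis \<psi>"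
      using sin_cos_squared_add[of \<psi>] by (simp add: complex_eq_iff power2_eq_square algebra_simps)
    moreover have "Y0 = cis \<phi> * (1 + of_real (sin \<psi>) * (\<i> * cis \<psi>))"
      unfolding Y0_def l evec_def Rpt_def by (simp add: distrib_left mult_ac)
    ultimately show ?thesis by (simp only: mult.left_commute)
  qed
  then have Y0n: "cmod Y0 = \<bar>cos \<psi>\<bar>" by (simp add: norm_mult)
  have cos1: "\<bar>cos \<psi>\<bar> < 1"
    using sin_cos_squared_add[of \<psi>] zero_less_power[OF sinp, of 2]
    unfolding abs_square_less_1[symmetric] by linarith
  \<comment> \<open>Along the line \<open>Im (cnj l * Y)\<close> is constantly
    \<open>- cos \<psi>\<close>, and it is bounded by \<open>cmod Y\<close> because \<open>l\<close>
    is a unit vector.\<close>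
  have low: "\<bar>cos \<psi>\<bar> \<le> cmod Y" if Y: "Y \<in> lambda1 K \<phi>" for Y
  proof -
    obtain t where "Y = Rpt \<phi> + of_real t * l"
      using Y unfolding lambda1_def l_def by blast
    then have "cnj l * Y = of_real t * (cnj l * l) - cnj l * (0 - Rpt \<phi>)"
      by (simp add: algebra_simps)
    then have "Im (cnj l * Y) = - cos \<psi>" using O unfolding ll by simp
    then show ?thesis
      using abs_Im_le_cmod[of "cnj l * Y"] by (simp add: norm_mult l evec_def)
  qed
  have "dist_line K \<phi> = artanh \<bar>cos \<psi>\<bar>"
    unfolding dist_line_def
  proof (rule cInf_eq_minimum)
    show "artanh \<bar>cos \<psi>\<bar> \<in> hdist 0 ` (lambda1 K \<phi> \<inter> kdisk)"
      using Y0l Y0n cos1 by (intro image_eqI[of _ _ Y0]) (auto simp: hdist_0 kdisk_def)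
    fix h assume "h \<in> hdist 0 ` (lambda1 K \<phi> \<inter> kdisk)"
    then obtain Y where Y: "Y \<in> lambda1 K \<phi>" "cmod Y < 1" "h = hdist 0 Y" by (auto simp: kdisk_def)
    have "(1 + \<bar>cos \<psi>\<bar>) / (1 - \<bar>cos \<psi>\<bar>) \<le> (1 + cmod Y) / (1 - cmod Y)"
      using low[OF Y(1)] Y(2) cos1 by (intro frac_le) auto
    then show "artanh \<bar>cos \<psi>\<bar> \<le> h"
      unfolding Y(3) hdist_0[OF Y(2)] artanh_def using cos1 Y(2)
      by (auto intro!: divide_right_mono ln_mono divide_pos_pos)
  qed
  then have dl: "sinh (dist_line K \<phi>) = \<bar>cot \<psi>\<bar>"
    using sinh_artanh_abs_cos[OF \<psi>] by simp
  have lam: "0 \<in> lambda1 K \<phi> \<longleftrightarrow> cos \<psi> = 0"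
    using low[of 0] Y0l Y0n by auto
  have left: "interior K \<subseteq> hp_left K \<phi>" using int by (auto simp: hp_left_def l_def)
  have right: "\<not> interior K \<subseteq> hp_right K \<phi>"
    using left assms(2) by (force simp: hp_left_def hp_right_def)
  have Ol: "0 \<in> hp_left K \<phi> \<longleftrightarrow> cos \<psi> > 0"
    using O unfolding hp_left_def l_def mem_Collect_eq by (simp only:)
  consider "cos \<psi> = 0" | "cos \<psi> > 0" | "cos \<psi> < 0" by linarith
  then show ?thesis
  proof cases
    case 1
    then show ?thesis by (simp add: sup rsig_def lam cot_def)
  next
    case 2
    then have "cot \<psi> > 0" using sinp by (simp add: cot_def)
    then show ?thesis using 2 by (simp add: sup rsig_def lam left Ol dl)
  next
    case 3
    then have "cot \<psi> < 0" using sinp by (simp add: cot_def divide_neg_pos)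
    then show ?thesis using 3 by (simp add: sup rsig_def lam left right Ol dl)
  qed
qed

section \<open>Reversal of lines\<close>

definition kmax :: "complex set \<Rightarrow> real \<Rightarrow> real" where
  "kmax K \<phi> = (SUP X\<in>K. kcot X \<phi>)"

definition kmin :: "complex set \<Rightarrow> real \<Rightarrow> real" where
  "kmin K \<phi> = (INF X\<in>K. kcot X \<phi>)"

lemma kmin_periodic: "kmin K (\<phi> + 2 * pi) = kmin K \<phi>"
  by (simp add: kmin_def kcot_periodic)

lemma compact_kdisk_radius:
  assumes "compact K" "K \<noteq> {}" "K \<subseteq> kdisk"
  obtains r where "0 \<le> r" "r < 1" "\<And>X. X \<in> K \<Longrightarrow> cmod X \<le> r"
proof -
  obtain X0 where "X0 \<in> K" "\<And>X. X \<in> K \<Longrightarrow> cmod X \<le> cmod X0"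
    using continuous_attains_sup[OF assms(1,2), of cmod] continuous_on_norm_id by blast
  then show thesis using assms(3) by (intro that[of "cmod X0"]) (auto simp: kdisk_def)
qed

lemma kmax_attained:
  assumes "compact K" "K \<noteq> {}" "K \<subseteq> kdisk"
  shows "\<exists>X\<in>K. kcot X \<phi> = kmax K \<phi>" "X \<in> K \<Longrightarrow> kcot X \<phi> \<le> kmax K \<phi>"
proof -
  obtain X0 where X0: "X0 \<in> K" "\<And>X. X \<in> K \<Longrightarrow> kcot X \<phi> \<le> kcot X0 \<phi>"
    using continuous_attains_sup[OF assms(1,2) continuous_on_kcot_fst[OF assms(3)]] by blast
  then have "kmax K \<phi> = kcot X0 \<phi>"
    unfolding kmax_def by (intro cSup_eq_maximum) auto
  with X0 show "\<exists>X\<in>K. kcot X \<phi> = kmax K \<phi>" "X \<in> K \<Longrightarrow> kcot X \<phi> \<le> kmax K \<phi>"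
    by auto
qed

lemma kmin_attained:
  assumes "compact K" "K \<noteq> {}" "K \<subseteq> kdisk"
  shows "\<exists>X\<in>K. kcot X \<phi> = kmin K \<phi>" "X \<in> K \<Longrightarrow> kmin K \<phi> \<le> kcot X \<phi>"
proof -
  obtain X0 where X0: "X0 \<in> K" "\<And>X. X \<in> K \<Longrightarrow> kcot X0 \<phi> \<le> kcot X \<phi>"
    using continuous_attains_inf[OF assms(1,2) continuous_on_kcot_fst[OF assms(3)]] by blast
  then have "kmin K \<phi> = kcot X0 \<phi>"
    unfolding kmin_def by (intro cInf_eq_minimum) auto
  with X0 show "\<exists>X\<in>K. kcot X \<phi> = kmin K \<phi>" "X \<in> K \<Longrightarrow> kmin K \<phi> \<le> kcot X \<phi>"
    by auto
qed

text \<open>A pointwise maximum of an equicontinuous family is continuous: the maximizing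
  \<open>X\<close> at one angle loses less than \<open>e\<close> at a nearby angle, where it still
  bounds the maximum from below. The roles of the two angles are symmetric.\<close>

lemma continuous_on_attained_max:
  fixes M :: "real \<Rightarrow> real"
  assumes attained: "\<And>\<phi>. \<exists>X\<in>K. F X \<phi> = M \<phi>" and ge: "\<And>X \<phi>. X \<in> K \<Longrightarrow> F X \<phi> \<le> M \<phi>"
    and equi: "\<And>e. 0 < e \<Longrightarrow> \<exists>d>0. \<forall>X\<in>K. \<forall>\<phi> \<theta>. \<bar>\<phi> - \<theta>\<bar> < d \<longrightarrow> \<bar>F X \<phi> - F X \<theta>\<bar> < e"
  shows "continuous_on UNIV M"
  unfolding continuous_on_iff
proof (intro ballI allI impI)
  fix \<theta> e :: real assume "0 < e"
  then obtain d where d: "d > 0" "\<forall>X\<in>K. \<forall>\<phi> \<theta>. \<bar>\<phi> - \<theta>\<bar> < d \<longrightarrow> \<bar>F X \<phi> - F X \<theta>\<bar> < e"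
    using equi[OF \<open>0 < e\<close>] by (elim exE conjE)
  have *: "M \<phi> < M \<theta> + e" if close: "\<bar>\<phi> - \<theta>\<bar> < d" for \<phi> \<theta>
  proof -
    obtain X where X: "X \<in> K" "F X \<phi> = M \<phi>" using attained by blast
    with d(2) close have "\<bar>F X \<phi> - F X \<theta>\<bar> < e" by blast
    then show ?thesis using X(2) ge[OF X(1), of \<theta>] by linarith
  qed
  have "dist (M \<phi>) (M \<theta>) < e" if "dist \<phi> \<theta> < d" for \<phi>
    using *[of \<phi> \<theta>] *[of \<theta> \<phi>] that by (simp add: dist_real_def abs_minus_commute abs_less_iff)
  with d(1) show "\<exists>d>0. \<forall>\<phi>\<in>UNIV. dist \<phi> \<theta> < d \<longrightarrow> dist (M \<phi>) (M \<theta>) < e" by blast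
qed

lemma continuous_on_kmax_kmin:
  assumes "compact K" "K \<noteq> {}" "K \<subseteq> kdisk"
  shows "continuous_on S (kmax K)" "continuous_on S (kmin K)"
proof -
  obtain r where r: "0 \<le> r" "r < 1" "\<And>X. X \<in> K \<Longrightarrow> cmod X \<le> r"
    using compact_kdisk_radius[OF assms] by blast
  have equi: "\<exists>d>0. \<forall>X\<in>K. \<forall>\<phi> \<theta>. \<bar>\<phi> - \<theta>\<bar> < d \<longrightarrow> \<bar>kcot X \<phi> - kcot X \<theta>\<bar> < e" if e: "0 < e" for e
  proof -
    obtain d where "0 < d" "\<And>X Y \<phi> \<theta>. cmod X \<le> r \<Longrightarrow> cmod Y \<le> r \<Longrightarrow> dist X Y < d \<Longrightarrow>
        \<bar>\<phi> - \<theta>\<bar> < d \<Longrightarrow> \<bar>kcot X \<phi> - kcot Y \<theta>\<bar> < e"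
      using kcot_uniformly_continuous[OF r(2) e] by blast
    then show ?thesis using r(3) by (metis dist_self)
  qed
  have "continuous_on UNIV (kmax K)"
    by (rule continuous_on_attained_max[of K kcot, OF kmax_attained[OF assms] equi])
  then show "continuous_on S (kmax K)" by (rule continuous_on_subset) simp
  have "continuous_on UNIV (\<lambda>\<phi>. - kmin K \<phi>)"
  proof (rule continuous_on_attained_max[of K "\<lambda>X \<phi>. - kcot X \<phi>"])
    show "\<exists>X\<in>K. - kcot X \<phi> = - kmin K \<phi>" for \<phi>
      using kmin_attained(1)[OF assms, of \<phi>] by simp
    show "- kcot X \<phi> \<le> - kmin K \<phi>" if "X \<in> K" for X \<phi>
      using kmin_attained(2)[OF assms that, of \<phi>] by simp
    show "\<exists>d>0. \<forall>X\<in>K. \<forall>\<phi> \<theta>. \<bar>\<phi> - \<theta>\<bar> < d \<longrightarrow> \<bar>- kcot X \<phi> - - kcot X \<theta>\<bar> < e" if "0 < e" for e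
      using equi[OF that] by (simp add: abs_minus_commute)
  qed
  then have "continuous_on UNIV (kmin K)" using continuous_on_minus by fastforce
  then show "continuous_on S (kmin K)" by (rule continuous_on_subset) simp
qed

text \<open>The common bound confines the levels \<open>u\<close> to a bounded interval when the
  extremes are later integrated over their levels.\<close>

lemma kcot_bounded:
  assumes "compact K" "K \<noteq> {}" "K \<subseteq> kdisk"
  obtains C where "\<And>X \<phi>. X \<in> K \<Longrightarrow> \<bar>kcot X \<phi>\<bar> \<le> C"
proof -
  obtain r where r: "0 \<le> r" "r < 1" "\<And>X. X \<in> K \<Longrightarrow> cmod X \<le> r"
    using compact_kdisk_radius[OF assms] by blast
  show thesis
  proof (rule that[of "1 / (1 - r)"])
    fix X \<phi> assume "X \<in> K"
    define w where "w = cis (- \<phi>) * X"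
    have "cmod w \<le> r" using r(3)[OF \<open>X \<in> K\<close>] by (simp add: w_def norm_mult)
    then have "\<bar>Im w\<bar> \<le> 1" "1 - r \<le> 1 - Re w"
      using abs_Im_le_cmod[of w] complex_Re_le_cmod[of w] r(2) by linarith+
    then have "\<bar>Im w\<bar> / (1 - Re w) \<le> 1 / (1 - r)"
      using r(2) by (intro frac_le) auto
    then show "\<bar>kcot X \<phi>\<bar> \<le> 1 / (1 - r)"
      unfolding kcot_def w_def[symmetric] using \<open>1 - r \<le> 1 - Re w\<close> r(2) by (simp add: abs_divide)
  qed
qed

text \<open>The oriented line through \<open>R(\<phi>)\<close> at angle \<open>arccot u = pi / 2 - arctan u\<close> from the tangent
  has its other ideal point at \<open>\<phi> + 2 arccot u\<close> and, read from there, cotangent \<open>- u\<close>.\<close>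

lemma kcot_reverse:
  assumes "cmod X < 1"
  shows "- u < kcot X (\<phi> + (pi - 2 * arctan u)) \<longleftrightarrow> kcot X \<phi> < u"
proof -
  define s where "s = pi / 2 - arctan u"
  have s: "0 < s" "s < pi"
    using arctan_lbound[of u] arctan_ubound[of u] by (simp_all add: s_def)
  then have sp: "sin s > 0" by (simp add: sin_gt_zero)
  have u: "u = cos s / sin s"
  proof -
    have "u = tan (arctan u)" by (simp only: tan_arctan)
    also have "\<dots> = cos s / sin s" by (simp only: s_def tan_def cos_diff sin_diff) simp
    finally show ?thesis .
  qed
  \<comment> \<open>Rotation by the midpoint \<phi> + s of the two ideal points places them at the
    angles \<open>- s\<close> and \<open>s\<close>. The line becomes the vertical
    \<open>Re z = cos s\<close>, and both inequalities reduce to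
    \<open>Re z < cos s\<close>.\<close>
  define z where "z = cis (- (\<phi> + s)) * X"
  have c1: "cis (- \<phi>) = cis s * cis (- (\<phi> + s))"
    and c2: "cis (- (\<phi> + 2 * s)) = cis (- s) * cis (- (\<phi> + s))"
    unfolding cis_mult by (rule arg_cong[where f = cis], simp)+
  have e1: "cis (- \<phi>) * X = cis s * z" and e2: "cis (- (\<phi> + 2 * s)) * X = cis (- s) * z"
    by (simp_all only: z_def c1 c2 mult.assoc)
  have p1: "1 - Re (cis s * z) > 0" and p2: "1 - Re (cis (- s) * z) > 0"
    unfolding e1[symmetric] e2[symmetric] using Re_cis_mult_less_1[OF assms] by (simp_all only: diff_gt_0_iff_gt)
  have q: "Re z * (cos s * cos s) + Re z * (sin s * sin s) = Re z"
    by (simp flip: distrib_left)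
  have "kcot X \<phi> < u \<longleftrightarrow> Im (cis s * z) * sin s < cos s * (1 - Re (cis s * z))"
    unfolding kcot_def e1 u using p1 sp by (simp add: divide_less_eq less_divide_eq mult.commute)
  also have "\<dots> \<longleftrightarrow> Re z < cos s"
    by (simp add: q algebra_simps)
  finally have 1: "kcot X \<phi> < u \<longleftrightarrow> Re z < cos s" .
  have "- u < kcot X (\<phi> + 2 * s) \<longleftrightarrow> - cos s * (1 - Re (cis (- s) * z)) < Im (cis (- s) * z) * sin s"
    unfolding kcot_def e2 u using p2 sp
    by (simp add: pos_less_divide_eq pos_divide_less_eq flip: minus_divide_left) (simp add: mult.commute field_simps)
  also have "\<dots> \<longleftrightarrow> Re z < cos s"
    by (simp add: q algebra_simps)
  finally have 2: "- u < kcot X (\<phi> + 2 * s) \<longleftrightarrow> Re z < cos s" .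
  have "pi - 2 * arctan u = 2 * s" by (simp add: s_def)
  then show ?thesis using 1 2 by simp
qed

text \<open>Both extremes are attained, so each strict inequality holds for the extreme exactly when
  it holds for every point of \<open>K\<close>; pointwise it is \<open>kcot_reverse\<close>.\<close>

lemma kmin_reverse:
  assumes "compact K" "K \<noteq> {}" "K \<subseteq> kdisk"
  shows "- u < kmin K (\<phi> + (pi - 2 * arctan u)) \<longleftrightarrow> kmax K \<phi> < u"
proof -
  have lt1: "cmod X < 1" if "X \<in> K" for X using that assms(3) by (auto simp: kdisk_def)
  have "- u < kmin K \<theta> \<longleftrightarrow> (\<forall>X\<in>K. - u < kcot X \<theta>)" for \<theta>
    using kmin_attained[OF assms] by (metis less_le_trans)
  moreover have "kmax K \<phi> < u \<longleftrightarrow> (\<forall>X\<in>K. kcot X \<phi> < u)"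
    using kmax_attained[OF assms] by (metis le_less_trans)
  ultimately show ?thesis using kcot_reverse lt1 by simp
qed

text \<open>The shifted period is cut at \<open>T\<close> and the part beyond is moved back by one
  period. Half-open intervals make the pieces fit without overlap.\<close>

lemma nn_integral_periodic_shift:
  fixes f :: "real \<Rightarrow> ennreal"
  assumes [measurable]: "f \<in> borel_measurable borel"
    and per: "\<And>x. f (x + T) = f x" and c: "0 \<le> c" "c \<le> T"
  shows "(\<integral>\<^sup>+x. indicator {0..<T} x * f (x + c) \<partial>lborel) = (\<integral>\<^sup>+x. indicator {0..<T} x * f x \<partial>lborel)"
proof -
  have "(\<integral>\<^sup>+x. indicator {0..<T} x * f (x + c) \<partial>lborel)
      = (\<integral>\<^sup>+x. indicator {c..<T + c} x * f x \<partial>lborel)"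
    by (subst (2) nn_integral_real_affine[where c = 1 and t = c])
      (auto intro!: nn_integral_cong simp: indicator_def add.commute)
  also have "\<dots> = (\<integral>\<^sup>+x. indicator {c..<T} x * f x + indicator {T..<T + c} x * f x \<partial>lborel)"
    using c by (intro nn_integral_cong) (auto simp: indicator_def)
  also have "\<dots> = (\<integral>\<^sup>+x. indicator {c..<T} x * f x \<partial>lborel) + (\<integral>\<^sup>+x. indicator {T..<T + c} x * f x \<partial>lborel)"
    by (intro nn_integral_add) auto
  also have "(\<integral>\<^sup>+x. indicator {T..<T + c} x * f x \<partial>lborel) = (\<integral>\<^sup>+x. indicator {0..<c} x * f x \<partial>lborel)"
    by (subst nn_integral_real_affine[where c = 1 and t = T])
      (auto intro!: nn_integral_cong simp: indicator_def add.commute[of T] per)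
  also have "(\<integral>\<^sup>+x. indicator {c..<T} x * f x \<partial>lborel) + \<dots>
      = (\<integral>\<^sup>+x. indicator {c..<T} x * f x + indicator {0..<c} x * f x \<partial>lborel)"
    by (intro nn_integral_add[symmetric]) auto
  also have "\<dots> = (\<integral>\<^sup>+x. indicator {0..<T} x * f x \<partial>lborel)"
    using c by (intro nn_integral_cong) (auto simp: indicator_def)
  finally show ?thesis .
qed

text \<open>\<open>C - kmax K \<phi>\<close> is the length of the set of levels \<open>u\<close> in
  \<open>{-C..C}\<close> above \<open>kmax K \<phi>\<close>, and \<open>C + kmin K \<phi>\<close>
  that of the levels with \<open>- u < kmin K \<phi>\<close>. For fixed \<open>u\<close> the
  reversal carries the first condition to the second by a rotation of \<phi>, so the two double
  integrals agree.\<close>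

lemma integral_kmax_kmin:
  assumes "compact K" "K \<noteq> {}" "K \<subseteq> kdisk"
  shows "integral {0..2*pi} (kmax K) + integral {0..2*pi} (kmin K) = 0"
proof -
  obtain C where C: "\<And>X \<phi>. X \<in> K \<Longrightarrow> \<bar>kcot X \<phi>\<bar> \<le> C" using kcot_bounded[OF assms] by blast
  have C1: "\<bar>kmax K \<phi>\<bar> \<le> C" and C2: "\<bar>kmin K \<phi>\<bar> \<le> C" for \<phi>
    using C kmax_attained(1)[OF assms, of \<phi>] kmin_attained(1)[OF assms, of \<phi>] by metis+
  have [measurable]: "kmax K \<in> borel_measurable borel" "kmin K \<in> borel_measurable borel"
    using continuous_on_kmax_kmin[OF assms] by (auto intro: borel_measurable_continuous_onI)
  let ?A = "\<lambda>\<phi>. indicator {0..<2*pi} \<phi> :: ennreal" and ?B = "\<lambda>u. indicator {-C..C} u :: ennreal"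
  have 1: "(\<integral>\<^sup>+u. ?B u * (if kmax K \<phi> < u then 1 else 0) \<partial>lborel) = ennreal (C - kmax K \<phi>)" for \<phi>
  proof -
    have "(\<integral>\<^sup>+u. ?B u * (if kmax K \<phi> < u then 1 else 0) \<partial>lborel) = (\<integral>\<^sup>+u. indicator {kmax K \<phi><..C} u \<partial>lborel)"
      using C1[of \<phi>] by (intro nn_integral_cong) (auto simp: indicator_def)
    also have "\<dots> = ennreal (C - kmax K \<phi>)" using C1[of \<phi>] by simp
    finally show ?thesis .
  qed
  have 2: "(\<integral>\<^sup>+u. ?B u * (if - u < kmin K \<phi> then 1 else 0) \<partial>lborel) = ennreal (C + kmin K \<phi>)" for \<phi>
  proof -
    have "(\<integral>\<^sup>+u. ?B u * (if - u < kmin K \<phi> then 1 else 0) \<partial>lborel) = (\<integral>\<^sup>+u. indicator {- kmin K \<phi><..C} u \<partial>lborel)"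
      using C2[of \<phi>] by (intro nn_integral_cong) (auto simp: indicator_def)
    also have "\<dots> = ennreal (C + kmin K \<phi>)" using C2[of \<phi>] by (simp add: add.commute)
    finally show ?thesis .
  qed
  have "(\<integral>\<^sup>+\<phi>. ?A \<phi> * ennreal (C - kmax K \<phi>) \<partial>lborel)
      = (\<integral>\<^sup>+\<phi>. (\<integral>\<^sup>+u. ?A \<phi> * (?B u * (if kmax K \<phi> < u then 1 else 0)) \<partial>lborel) \<partial>lborel)"
    unfolding 1[symmetric] by (simp add: nn_integral_cmult)
  also have "\<dots> = (\<integral>\<^sup>+u. (\<integral>\<^sup>+\<phi>. ?A \<phi> * (?B u * (if kmax K \<phi> < u then 1 else 0)) \<partial>lborel) \<partial>lborel)"
    \<comment> \<open>The angle of rotation depends on \<open>u\<close>, so \<open>u\<close> has to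
      be the outer variable before shifting.\<close>
    by (rule lborel_pair.Fubini') measurable
  also have "\<dots> = (\<integral>\<^sup>+u. (\<integral>\<^sup>+\<phi>. ?A \<phi> * (?B u * (if - u < kmin K \<phi> then 1 else 0)) \<partial>lborel) \<partial>lborel)"
  proof (rule nn_integral_cong)
    fix u :: real
    have "(\<integral>\<^sup>+\<phi>. ?A \<phi> * (?B u * (if kmax K \<phi> < u then 1 else 0)) \<partial>lborel)
      = (\<integral>\<^sup>+\<phi>. ?A \<phi> * (?B u * (if - u < kmin K (\<phi> + (pi - 2 * arctan u)) then 1 else 0)) \<partial>lborel)"
      by (simp add: kmin_reverse[OF assms])
    also have "\<dots> = (\<integral>\<^sup>+\<phi>. ?A \<phi> * (?B u * (if - u < kmin K \<phi> then 1 else 0)) \<partial>lborel)"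
      using arctan_lbound[of u] arctan_ubound[of u]
      by (intro nn_integral_periodic_shift[where f = "\<lambda>\<phi>. ?B u * (if - u < kmin K \<phi> then 1 else 0)"])
        (auto simp: kmin_periodic)
    finally show "(\<integral>\<^sup>+\<phi>. ?A \<phi> * (?B u * (if kmax K \<phi> < u then 1 else 0)) \<partial>lborel)
      = (\<integral>\<^sup>+\<phi>. ?A \<phi> * (?B u * (if - u < kmin K \<phi> then 1 else 0)) \<partial>lborel)" .
  qed
  also have "\<dots> = (\<integral>\<^sup>+\<phi>. (\<integral>\<^sup>+u. ?A \<phi> * (?B u * (if - u < kmin K \<phi> then 1 else 0)) \<partial>lborel) \<partial>lborel)"
    by (rule lborel_pair.Fubini') measurable
  also have "\<dots> = (\<integral>\<^sup>+\<phi>. ?A \<phi> * ennreal (C + kmin K \<phi>) \<partial>lborel)"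
    unfolding 2[symmetric] by (simp add: nn_integral_cmult)
  finally have eq: "(\<integral>\<^sup>+\<phi>. ?A \<phi> * ennreal (C - kmax K \<phi>) \<partial>lborel) = (\<integral>\<^sup>+\<phi>. ?A \<phi> * ennreal (C + kmin K \<phi>) \<partial>lborel)" .
  \<comment> \<open>Return to the gauge integral over the closed interval, which differs from the
    half-open period only by the null set \<open>{2*pi}\<close>.\<close>
  have toHK: "(\<integral>\<^sup>+\<phi>. ?A \<phi> * ennreal (f \<phi>) \<partial>lborel) = ennreal (integral {0..2*pi} f)"
    if "continuous_on {0..2*pi} f" "\<And>\<phi>. 0 \<le> f \<phi>" for f :: "real \<Rightarrow> real"
  proof -
    have "(f has_integral integral {0..2*pi} f) {0..2*pi}"
      by (intro integrable_integral integrable_continuous_interval that)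
    moreover have "negligible {x \<in> {0..<2*pi} - {0..2*pi}. f x \<noteq> 0}" "negligible {x \<in> {0..2*pi} - {0..<2*pi}. f x \<noteq> 0}"
      by (rule negligible_subset[of "{2*pi}"]; auto)+
    ultimately have "(f has_integral integral {0..2*pi} f) {0..<2*pi}"
      using has_integral_spike_set_eq by blast
    from nn_integral_has_integral_lebesgue'[OF _ this] that(2) show ?thesis
      by (simp add: mult.commute)
  qed
  have cont: "continuous_on {0..2*pi} (kmax K)" "continuous_on {0..2*pi} (kmin K)"
    using continuous_on_kmax_kmin[OF assms] .
  have nn: "0 \<le> C - kmax K \<phi>" "0 \<le> C + kmin K \<phi>" for \<phi>
    using C1[of \<phi>] C2[of \<phi>] by linarith+
  have "ennreal (integral {0..2*pi} (\<lambda>\<phi>. C - kmax K \<phi>)) = ennreal (integral {0..2*pi} (\<lambda>\<phi>. C + kmin K \<phi>))"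
    using eq by (subst (asm) (1 2) toHK) (auto intro!: continuous_intros cont nn simp: C1[THEN abs_le_D1])
  then have "integral {0..2*pi} (\<lambda>\<phi>. C - kmax K \<phi>) = integral {0..2*pi} (\<lambda>\<phi>. C + kmin K \<phi>)"
    using nn by (subst (asm) ennreal_inj) (auto intro!: integral_nonneg integrable_continuous_interval continuous_intros cont)
  moreover have "integral {0..2*pi} (\<lambda>\<phi>. C - kmax K \<phi>) = integral {0..2*pi} (\<lambda>\<phi>. C) - integral {0..2*pi} (kmax K)"
    by (intro integral_diff integrable_continuous_interval continuous_intros cont)
  moreover have "integral {0..2*pi} (\<lambda>\<phi>. C + kmin K \<phi>) = integral {0..2*pi} (\<lambda>\<phi>. C) + integral {0..2*pi} (kmin K)"
    by (intro integral_add integrable_continuous_interval continuous_intros cont)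
  ultimately show ?thesis by linarith
qed

section \<open>Variation along the boundary\<close>

lemma partition_mono:
  fixes t :: "nat \<Rightarrow> real"
  assumes "\<And>i. i < n \<Longrightarrow> t i \<le> t (Suc i)" "i \<le> j" "j \<le> n"
  shows "t i \<le> t j"
  using assms(2,3) by (induction j rule: dec_induct) (auto intro: order_trans[OF _ assms(1)])

lemma partition_mem:
  fixes t :: "nat \<Rightarrow> real"
  assumes "t 0 = 0" "t n = 1" "\<And>i. i < n \<Longrightarrow> t i \<le> t (Suc i)" "i \<le> n"
  shows "t i \<in> {0..1}"
  using partition_mono[of n t 0 i] partition_mono[of n t i n] assms by auto

text \<open>Banach's indicatrix: each increment is the length of the interval of levels crossed on
  its piece, and a level is crossed on at most as many pieces as it has preimages. The half-open
  \<open>{0..<1}\<close> counts the common endpoint of a closed curve once.\<close>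

lemma sum_abs_diff_le_level_count:
  fixes F :: "real \<Rightarrow> real"
  assumes cont: "continuous_on {0..1} F"
    and t: "t 0 = 0" "t n = 1" "\<And>i. i < n \<Longrightarrow> t i \<le> t (Suc i)"
    and bd: "\<And>s. s \<in> {0..1} \<Longrightarrow> m \<le> F s \<and> F s \<le> M"
    and lev: "\<And>u. m < u \<Longrightarrow> u < M \<Longrightarrow> finite {s\<in>{0..<1}. F s = u} \<and> card {s\<in>{0..<1}. F s = u} \<le> 2"
  shows "(\<Sum>i<n. \<bar>F (t (Suc i)) - F (t i)\<bar>) \<le> 2 * (M - m)"
proof -
  note mono = partition_mono[of n t, OF t(3)] and t01 = partition_mem[of t n, OF t]
  \<comment> \<open>Open intervals force the preimage of a level into the interior of its piece, so
    different pieces yield different preimages.\<close>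
  define J where "J = (\<lambda>i. {min (F (t i)) (F (t (Suc i)))<..<max (F (t i)) (F (t (Suc i)))})"
  have point: "(\<Sum>i<n. indicator (J i) u :: real) \<le> 2 * indicator {m..M} u" (is "?L \<le> ?R") for u :: real
  proof -
    define N where "N = {i. i < n \<and> u \<in> J i}"
      have L: "?L = real (card N)"
    proof -
      have "?L = (\<Sum>i<n. if i \<in> N then 1 else 0)"
        by (intro sum.cong) (auto simp: N_def indicator_def)
      also have "\<dots> = (\<Sum>i\<in>{..<n} \<inter> N. 1)" by (subst sum.inter_restrict) auto
      also have "{..<n} \<inter> N = N" by (auto simp: N_def)
      finally show ?thesis by simp
    qed
    show ?thesis
    proof (cases "N = {}")
      case True
      then show ?thesis by (simp add: L)
    next
      case False
      have u: "m < u" "u < M"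
      proof -
        from False obtain i where "i < n" "u \<in> J i" by (auto simp: N_def)
        then show "m < u" "u < M"
          using bd[of "t i"] bd[of "t (Suc i)"] t01[of i] t01[of "Suc i"] by (auto simp: J_def)
      qed
      have "\<exists>s. t i < s \<and> s < t (Suc i) \<and> F s = u" if "i \<in> N" for i
      proof -
        have i: "i < n" "u \<in> J i" using that by (auto simp: N_def)
        have c: "continuous_on {t i..t (Suc i)} F"
          using t01[of i] t01[of "Suc i"] i(1) by (intro continuous_on_subset[OF cont]) auto
        have "\<exists>s. t i \<le> s \<and> s \<le> t (Suc i) \<and> F s = u"
          using IVT'[of F "t i" u "t (Suc i)", OF _ _ t(3)[OF i(1)] c]
            IVT2'[of F "t (Suc i)" u "t i", OF _ _ t(3)[OF i(1)] c] i(2)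
          by (fastforce simp: J_def min_def max_def split: if_splits)
        then obtain s where s: "t i \<le> s" "s \<le> t (Suc i)" "F s = u" by blast
        moreover have "s \<noteq> t i" "s \<noteq> t (Suc i)" using s(3) i(2) by (auto simp: J_def)
        ultimately show ?thesis by (intro exI[of _ s]) auto
      qed
      then obtain s where s: "\<And>i. i \<in> N \<Longrightarrow> t i < s i \<and> s i < t (Suc i) \<and> F (s i) = u" by metis
      have less: "s i < s j" if "i \<in> N" "j \<in> N" "i < j" for i j
        using s[OF that(1)] s[OF that(2)] mono[of "Suc i" j] that by (force simp: N_def)
      have "inj_on s N"
        by (rule inj_onI) (metis less less_irrefl linorder_neqE_nat)
      moreover have "s ` N \<subseteq> {s\<in>{0..<1}. F s = u}"
      proof safe
        fix i assume "i \<in> N"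
        then show "s i \<in> {0..<1}" "F (s i) = u"
          using s[of i] t01[of i] t01[of "Suc i"] by (auto simp: N_def)
      qed
      ultimately have "card N \<le> 2"
        using lev[OF u] card_inj_on_le[of s N] by (meson order_trans)
      then show ?thesis using u by (simp add: L)
    qed
  qed
  have mM: "m \<le> M" using bd[of 0] by auto
  have "(\<Sum>i<n. \<bar>F (t (Suc i)) - F (t i)\<bar>) = (\<Sum>i<n. measure lborel (J i))"
    by (intro sum.cong) (auto simp: J_def)
  also have "\<dots> = (\<integral>u. (\<Sum>i<n. indicator (J i) u) \<partial>lborel)"
    by (subst Bochner_Integration.integral_sum) (auto simp: J_def)
  also have "\<dots> \<le> (\<integral>u. 2 * indicator {m..M} u \<partial>lborel)"
    using mM by (intro integral_mono point) (auto simp: J_def)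
  also have "\<dots> = 2 * (M - m)" using mM by simp
  finally show ?thesis .
qed

text \<open>A closed sequence travels from one of the two values to the other and back. The return
  trip consists of the end and the beginning of the index range, joined by
  \<open>a n = a 0\<close>.\<close>

lemma closed_variation_ge:
  fixes a :: "nat \<Rightarrow> real"
  assumes "a n = a 0" "j \<le> n" "k \<le> n"
  shows "2 * (a j - a k) \<le> (\<Sum>i<n. \<bar>a (Suc i) - a i\<bar>)"
proof -
  let ?d = "\<lambda>i. \<bar>a (Suc i) - a i\<bar>"
  have seg: "\<bar>a q - a p\<bar> \<le> sum ?d {p..<q}" if "p \<le> q" for p q
  proof -
    have "a q - a p = (\<Sum>i=p..<q. a (Suc i) - a i)" using that by (simp add: sum_Suc_diff')
    then show ?thesis by (metis (no_types) sum_abs)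
  qed
  have *: "2 * \<bar>a q - a p\<bar> \<le> (\<Sum>i<n. ?d i)" if "p \<le> q" "q \<le> n" for p q
  proof -
    have "2 * \<bar>a q - a p\<bar> \<le> \<bar>a p - a 0\<bar> + \<bar>a q - a p\<bar> + \<bar>a n - a q\<bar>"
      using abs_triangle_ineq4[of "a q - a 0" "a p - a 0"] assms(1)
      by (simp add: abs_minus_commute)
    also have "\<dots> \<le> sum ?d {0..<p} + sum ?d {p..<q} + sum ?d {q..<n}"
      using that by (intro add_mono seg) auto
    also have "\<dots> = (\<Sum>i<n. ?d i)"
      using that by (simp add: lessThan_atLeast0 sum.atLeastLessThan_concat)
    finally show ?thesis .
  qed
  have "2 * (a j - a k) \<le> 2 * \<bar>a k - a j\<bar>"
    using abs_ge_self[of "a j - a k"] by (simp add: abs_minus_commute)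
  also have "\<dots> \<le> (\<Sum>i<n. ?d i)"
    using *[of j k] *[of k j] assms by (cases "j \<le> k") (simp_all add: abs_minus_commute)
  finally show ?thesis .
qed

section \<open>Lines meeting the frontier of a plane convex set\<close>

lemma inner_eq_0_complex:
  fixes a Y :: complex
  assumes "a \<noteq> 0" "inner a Y = 0"
  shows "\<exists>\<tau>. Y = of_real \<tau> * (\<i> * a)"
proof -
  have n: "(Re a)\<^sup>2 + (Im a)\<^sup>2 \<noteq> 0" using assms(1) by (simp add: complex_eq_iff sum_power2_eq_zero_iff)
  have o: "Re a * Re Y + Im a * Im Y = 0" using assms(2) by (simp add: inner_complex_def)
  define \<tau> where "\<tau> = (Re a * Im Y - Im a * Re Y) / ((Re a)\<^sup>2 + (Im a)\<^sup>2)"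
  have \<tau>: "\<tau> * ((Re a)\<^sup>2 + (Im a)\<^sup>2) = Re a * Im Y - Im a * Re Y" using n by (simp add: \<tau>_def)
  have "Re Y = - (\<tau> * Im a)"
    by (rule mult_right_cancel[OF n, THEN iffD1]) (use o \<tau> in algebra)
  moreover have "Im Y = \<tau> * Re a"
    by (rule mult_right_cancel[OF n, THEN iffD1]) (use o \<tau> in algebra)
  ultimately have "Y = of_real \<tau> * (\<i> * a)" by (simp add: complex_eq_iff)
  then show ?thesis by blast
qed

text \<open>A supporting line at the middle point \<open>y\<close> has \<open>x\<close> and
  \<open>z\<close> on one closed side, so it must contain both and equal the line
  \<open>inner a w = u\<close>. But \<open>p\<close> and \<open>q\<close> lie strictly on opposite
  sides of that line.\<close>

lemma convex_frontier_not_collinear: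
  fixes a :: complex
  assumes "convex K" "closed K" "interior K \<noteq> {}" "a \<noteq> 0"
    and "p \<in> K" "inner a p < u" "q \<in> K" "u < inner a q"
    and "x \<in> K" "y \<in> frontier K" "z \<in> K" "inner a x = u" "inner a y = u" "inner a z = u"
    and "inner (\<i> * a) x < inner (\<i> * a) y" "inner (\<i> * a) y < inner (\<i> * a) z"
  shows False
proof -
  have "y \<in> closure K" "y \<notin> rel_interior K"
    using assms(1-3,10) by (auto simp: frontier_def rel_interior_nonempty_interior)
  then obtain b where b: "b \<noteq> 0" "\<And>w. w \<in> closure K \<Longrightarrow> inner b y \<le> inner b w"
    using supporting_hyperplane_relative_frontier[OF assms(1)] by metis
  then have bK: "0 \<le> inner b (w - y)" if "w \<in> K" for w
    using that closure_subset by (force simp: inner_diff_right)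
  obtain \<sigma> where \<sigma>: "x - y = of_real \<sigma> * (\<i> * a)"
    using inner_eq_0_complex[OF assms(4), of "x - y"] assms by (auto simp: inner_diff_right)
  obtain \<tau> where \<tau>: "z - y = of_real \<tau> * (\<i> * a)"
    using inner_eq_0_complex[OF assms(4), of "z - y"] assms by (auto simp: inner_diff_right)
  have sc: "inner v (of_real s * (\<i> * a)) = s * inner v (\<i> * a)" for v s
    by (metis inner_scaleR_right scaleR_conv_of_real)
  have pos: "inner (\<i> * a) (\<i> * a) > 0" using assms(4) by simp
  have "inner (\<i> * a) (x - y) < 0" "inner (\<i> * a) (z - y) > 0"
    using assms(15,16) by (simp_all only: inner_diff_right diff_less_0_iff_less diff_gt_0_iff_gt)
  then have "\<sigma> < 0" "\<tau> > 0"
    using pos unfolding \<sigma> \<tau> sc by (auto simp: mult_less_0_iff zero_less_mult_iff simp del: inner_gt_zero_iff)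
  then have "inner b (\<i> * a) = 0"
    using bK[OF assms(9)] bK[OF assms(11)] unfolding \<sigma> \<tau> sc
    by (auto simp: zero_le_mult_iff)
  \<comment> \<open>\<open>b\<close> is orthogonal to \<open>\<i> * a\<close>, so it is a multiple
    of \<open>\<i> * (\<i> * a) = - a\<close>: the supporting line is parallel to the given
    one.\<close>
  then obtain \<kappa> where "b = of_real \<kappa> * (\<i> * (\<i> * a))"
    using inner_eq_0_complex[of "\<i> * a" b] assms(4) by (auto simp: inner_commute)
  then have "b = (- \<kappa>) *\<^sub>R a" by (simp add: scaleR_conv_of_real)
  then obtain k where k: "b = k *\<^sub>R a" by blast
  with b(1) have "k \<noteq> 0" by auto
  have "0 \<le> k * (inner a p - u)" "0 \<le> k * (inner a q - u)"
    using bK[OF assms(5)] bK[OF assms(7)] assms(13) unfolding k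
    by (simp_all add: inner_diff_right right_diff_distrib)
  then show False using assms(6,8) \<open>k \<noteq> 0\<close> by (auto simp: zero_le_mult_iff)
qed

lemma card_le_2I:
  assumes "\<And>x y z. x \<in> S \<Longrightarrow> y \<in> S \<Longrightarrow> z \<in> S \<Longrightarrow> x = y \<or> y = z \<or> x = z"
  shows "finite S \<and> card S \<le> 2"
proof (rule ccontr)
  assume "\<not> (finite S \<and> card S \<le> 2)"
  then have "\<exists>T\<subseteq>S. card T = 3"
    by (metis infinite_arbitrarily_large not_less_eq_eq numeral_3_eq_3 numeral_2_eq_2 obtain_subset_with_card_n)
  then show False using assms by (auto simp: card_3_iff)
qed

text \<open>The coordinate \<open>?c\<close> is injective on the line, so three distinct points
  could be ordered along it, and the middle one would contradict the preceding result.\<close>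

lemma convex_frontier_line_card:
  fixes a :: complex
  assumes "convex K" "closed K" "interior K \<noteq> {}" "a \<noteq> 0"
    and "p \<in> K" "inner a p < u" "q \<in> K" "u < inner a q"
  shows "finite {X \<in> frontier K. inner a X = u} \<and> card {X \<in> frontier K. inner a X = u} \<le> 2"
proof (rule card_le_2I, rule ccontr)
  fix x y z
  assume S: "x \<in> {X \<in> frontier K. inner a X = u}" "y \<in> {X \<in> frontier K. inner a X = u}"
    "z \<in> {X \<in> frontier K. inner a X = u}" and ne: "\<not> (x = y \<or> y = z \<or> x = z)"
  have fK: "frontier K \<subseteq> K" using assms(2) by (simp add: frontier_subset_closed)
  note no = convex_frontier_not_collinear[OF assms]
  let ?c = "\<lambda>v. inner (\<i> * a) v"
  have inj: "?c v \<noteq> ?c w" if vw: "inner a v = u" "inner a w = u" "v \<noteq> w" for v w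
  proof
    assume eq: "?c v = ?c w"
    obtain \<tau> where \<tau>: "v - w = of_real \<tau> * (\<i> * a)"
      using inner_eq_0_complex[OF assms(4), of "v - w"] vw by (auto simp: inner_diff_right)
    have "inner (v - w) (v - w) = \<tau> * ?c (v - w)"
      unfolding \<tau> by (metis inner_scaleR_left scaleR_conv_of_real)
    also have "\<dots> = 0" using eq by (simp add: inner_diff_right)
    finally show False using vw(3) by simp
  qed
  have "?c x \<noteq> ?c y" "?c y \<noteq> ?c z" "?c x \<noteq> ?c z" 
    using inj[of x y] inj[of y z] inj[of x z] S ne by auto
  then consider "?c x < ?c y" "?c y < ?c z" | "?c z < ?c y" "?c y < ?c x"
    | "?c y < ?c x" "?c x < ?c z" | "?c z < ?c x" "?c x < ?c y"
    | "?c x < ?c z" "?c z < ?c y" | "?c y < ?c z" "?c z < ?c x"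
    by linarith
  then show False by cases (use no S fK in blast)+
qed

lemma not_interior_linear_max:
  fixes a :: "'a::real_inner"
  assumes "a \<noteq> 0" "\<And>Y. Y \<in> K \<Longrightarrow> inner a Y \<le> inner a X"
  shows "X \<notin> interior K"
proof
  assume "X \<in> interior K"
  then obtain e where e: "e > 0" "cball X e \<subseteq> K" by (auto simp: mem_interior_cball)
  then have "X + (e / norm a) *\<^sub>R a \<in> K"
    using assms(1) by (intro subsetD[OF e(2)]) (simp add: dist_norm)
  from assms(2)[OF this] have "(e / norm a) * inner a a \<le> 0" by (simp add: inner_add_right)
  moreover have "(e / norm a) * inner a a > 0" using e(1) assms(1) by simp
  ultimately show False by simp
qed

section \<open>The length of the boundary\<close>

text \<open>Clearing the denominator in \<open>kcot X \<phi> = u\<close> leaves the linear equation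
  \<open>inner (line_normal \<phi> u) X = u\<close>, satisfied also by \<open>Rpt \<phi>\<close>:
  level sets of the cotangent are chords through the ideal point.\<close>

definition line_normal :: "real \<Rightarrow> real \<Rightarrow> complex" where
  "line_normal \<phi> u = Complex (u * cos \<phi> - sin \<phi>) (u * sin \<phi> + cos \<phi>)"

lemma kcot_halfplane:
  assumes "cmod X < 1"
  shows "kcot X \<phi> < u \<longleftrightarrow> inner (line_normal \<phi> u) X < u" "kcot X \<phi> = u \<longleftrightarrow> inner (line_normal \<phi> u) X = u"
    "u < kcot X \<phi> \<longleftrightarrow> u < inner (line_normal \<phi> u) X" "line_normal \<phi> u \<noteq> 0"
proof -
  have p: "1 - Re (cis (- \<phi>) * X) > 0"
    using Re_cis_mult_less_1[OF assms(1), of "- \<phi>"] by linarith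
  have "inner (line_normal \<phi> u) X - u = Im (cis (- \<phi>) * X) - u * (1 - Re (cis (- \<phi>) * X))"
    by (simp add: line_normal_def inner_complex_def algebra_simps)
  also have "\<dots> = (kcot X \<phi> - u) * (1 - Re (cis (- \<phi>) * X))"
    using p unfolding kcot_def left_diff_distrib by simp
  finally have e: "inner (line_normal \<phi> u) X - u = (kcot X \<phi> - u) * (1 - Re (cis (- \<phi>) * X))" .
  have "inner (line_normal \<phi> u) X < u \<longleftrightarrow> inner (line_normal \<phi> u) X - u < 0" by simp
  also have "\<dots> \<longleftrightarrow> kcot X \<phi> < u" unfolding e using p by (simp only: mult_less_0_iff) auto
  finally show "kcot X \<phi> < u \<longleftrightarrow> inner (line_normal \<phi> u) X < u" by simp
  have "u < inner (line_normal \<phi> u) X \<longleftrightarrow> 0 < inner (line_normal \<phi> u) X - u" by simp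
  also have "\<dots> \<longleftrightarrow> u < kcot X \<phi>" unfolding e using p by (simp only: zero_less_mult_iff) auto
  finally show "u < kcot X \<phi> \<longleftrightarrow> u < inner (line_normal \<phi> u) X" by simp
  have "inner (line_normal \<phi> u) X = u \<longleftrightarrow> inner (line_normal \<phi> u) X - u = 0" by simp
  also have "\<dots> \<longleftrightarrow> kcot X \<phi> = u" unfolding e using p by (simp only: mult_eq_0_iff) auto
  finally show "kcot X \<phi> = u \<longleftrightarrow> inner (line_normal \<phi> u) X = u" by simp
  show "line_normal \<phi> u \<noteq> 0"
  proof
    assume "line_normal \<phi> u = 0"
    then have 1: "sin \<phi> = u * cos \<phi>" and 2: "u * sin \<phi> + cos \<phi> = 0" by (simp_all add: line_normal_def complex_eq_iff)
    have "(sin \<phi>)\<^sup>2 + (cos \<phi>)\<^sup>2 = cos \<phi> * (u * sin \<phi> + cos \<phi>)"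
      unfolding 1 by (simp add: power2_eq_square algebra_simps)
    then show False unfolding 2 by simp
  qed
qed

text \<open>A point of extreme cotangent maximizes a nonzero linear functional on \<open>K\<close>
  (for the minimum, the one with normal \<open>- a\<close>), so it cannot be interior. The boundary
  curve therefore reaches both extremes.\<close>

lemma kmax_kmin_frontier:
  assumes "compact K" "K \<noteq> {}" "K \<subseteq> kdisk"
  shows "\<exists>X\<in>frontier K. kcot X \<phi> = kmax K \<phi>" "\<exists>X\<in>frontier K. kcot X \<phi> = kmin K \<phi>"
proof -
  have lt1: "cmod X < 1" if "X \<in> K" for X using that assms(3) by (auto simp: kdisk_def)
  have fr: "X \<in> frontier K" if "X \<in> K" "X \<notin> interior K" for X
    using that closure_subset by (auto simp: frontier_def)
  note h = kcot_halfplane[where \<phi> = \<phi>]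
  obtain X where X: "X \<in> K" "kcot X \<phi> = kmax K \<phi>" using kmax_attained(1)[OF assms] by blast
  define a where "a = line_normal \<phi> (kmax K \<phi>)"
  have "inner a Y \<le> inner a X" if "Y \<in> K" for Y
    using kmax_attained(2)[OF assms that, of \<phi>] h(3)[OF lt1[OF that], of "kmax K \<phi>"]
      h(2)[OF lt1[OF X(1)], of "kmax K \<phi>"] X(2) unfolding a_def by linarith
  moreover have "a \<noteq> 0" unfolding a_def by (rule h(4)[OF lt1[OF X(1)]])
  ultimately have "X \<notin> interior K" by (intro not_interior_linear_max)
  then show "\<exists>X\<in>frontier K. kcot X \<phi> = kmax K \<phi>" using X fr by blast
  obtain X where X: "X \<in> K" "kcot X \<phi> = kmin K \<phi>" using kmin_attained(1)[OF assms] by blast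
  define a where "a = line_normal \<phi> (kmin K \<phi>)"
  have "inner (- a) Y \<le> inner (- a) X" if "Y \<in> K" for Y
    using kmin_attained(2)[OF assms that, of \<phi>] h(1)[OF lt1[OF that], of "kmin K \<phi>"]
      h(2)[OF lt1[OF X(1)], of "kmin K \<phi>"] X(2) unfolding a_def inner_minus_left by linarith
  moreover have "- a \<noteq> 0" unfolding a_def using h(4)[OF lt1[OF X(1)]] by simp
  ultimately have "X \<notin> interior K" by (intro not_interior_linear_max)
  then show "\<exists>X\<in>frontier K. kcot X \<phi> = kmin K \<phi>" using X fr by blast
qed

lemma kcot_frontier_card:
  assumes "compact K" "convex K" "interior K \<noteq> {}" "K \<subseteq> kdisk"
    and "kmin K \<phi> < u" "u < kmax K \<phi>"
  shows "finite {X \<in> frontier K. kcot X \<phi> = u} \<and> card {X \<in> frontier K. kcot X \<phi> = u} \<le> 2"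
proof -
  have ne: "K \<noteq> {}" using assms(3) interior_subset by blast
  have lt1: "cmod X < 1" if "X \<in> K" for X using that assms(4) by (auto simp: kdisk_def)
  have fK: "frontier K \<subseteq> K" using assms(1) by (simp add: frontier_subset_closed compact_imp_closed)
  define a where "a = line_normal \<phi> u"
  obtain p where p: "p \<in> K" "kcot p \<phi> < u" using kmin_attained(1)[OF assms(1) ne assms(4)] assms(5) by metis
  obtain q where q: "q \<in> K" "u < kcot q \<phi>" using kmax_attained(1)[OF assms(1) ne assms(4)] assms(6) by metis
  have "inner a p < u" "u < inner a q" "a \<noteq> 0"
    using kcot_halfplane(1)[OF lt1[OF p(1)]] kcot_halfplane(3,4)[OF lt1[OF q(1)]] p q
    unfolding a_def by blast+
  from convex_frontier_line_card[OF assms(2) compact_imp_closed[OF assms(1)] assms(3) this(3) p(1) this(1) q(1) this(2)]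
  have "finite {X \<in> frontier K. inner a X = u} \<and> card {X \<in> frontier K. inner a X = u} \<le> 2" .
  moreover have "{X \<in> frontier K. kcot X \<phi> = u} = {X \<in> frontier K. inner a X = u}"
    using kcot_halfplane(2) lt1 fK unfolding a_def by blast
  ultimately show ?thesis by simp
qed

section \<open>Inscribed polygons and the length of the boundary curve\<close>

locale klein_boundary =
  fixes K :: "complex set" and \<gamma> :: "real \<Rightarrow> complex"
  assumes K: "compact K" "convex K" "interior K \<noteq> {}" "K \<subseteq> kdisk"
    and \<gamma>: "simple_path \<gamma>" "pathfinish \<gamma> = pathstart \<gamma>" "path_image \<gamma> = frontier K"
begin

lemma K_nonempty: "K \<noteq> {}"
  using K(3) interior_subset by blast

lemma path_in: "s \<in> {0..1} \<Longrightarrow> \<gamma> s \<in> frontier K" "s \<in> {0..1} \<Longrightarrow> \<gamma> s \<in> K"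
  "s \<in> {0..1} \<Longrightarrow> cmod (\<gamma> s) < 1"
proof -
  assume s: "s \<in> {0..1}"
  then show f: "\<gamma> s \<in> frontier K" using \<gamma>(3) by (auto simp: path_image_def)
  then show k: "\<gamma> s \<in> K"
    using K(1) by (meson compact_imp_closed frontier_subset_closed subsetD)
  then show "cmod (\<gamma> s) < 1" using K(4) by (auto simp: kdisk_def)
qed

lemma continuous_path: "continuous_on {0..1} \<gamma>"
  using \<gamma>(1) by (simp add: simple_path_def path_def)

lemma polygon_has_integral:
  assumes "\<And>i. i \<le> n \<Longrightarrow> t i \<in> {0..1}"
  shows "((\<lambda>\<phi>. \<Sum>i<n. \<bar>kcot (\<gamma> (t (Suc i))) \<phi> - kcot (\<gamma> (t i)) \<phi>\<bar>) has_integral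
    4 * (\<Sum>i<n. hdist (\<gamma> (t i)) (\<gamma> (t (Suc i))))) {0..2*pi}"
  unfolding sum_distrib_left
proof (rule has_integral_sum)
  fix i assume "i \<in> {..<n}"
  then have "t i \<in> {0..1}" "t (Suc i) \<in> {0..1}" using assms by auto
  then show "((\<lambda>\<phi>. \<bar>kcot (\<gamma> (t (Suc i))) \<phi> - kcot (\<gamma> (t i)) \<phi>\<bar>) has_integral
      4 * hdist (\<gamma> (t i)) (\<gamma> (t (Suc i)))) {0..2*pi}"
    by (intro hdist_integral path_in(3))
qed simp

lemma width_has_integral:
  "((\<lambda>\<phi>. kmax K \<phi> - kmin K \<phi>) has_integral 2 * integral {0..2*pi} (kmax K)) {0..2*pi}"
proof -
  note c = continuous_on_kmax_kmin[OF K(1) K_nonempty K(4)]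
  have "((\<lambda>\<phi>. kmax K \<phi> - kmin K \<phi>) has_integral
      integral {0..2*pi} (kmax K) - integral {0..2*pi} (kmin K)) {0..2*pi}"
    by (intro has_integral_diff integrable_integral integrable_continuous_interval c)
  moreover have "integral {0..2*pi} (kmax K) - integral {0..2*pi} (kmin K) = 2 * integral {0..2*pi} (kmax K)"
    using integral_kmax_kmin[OF K(1) K_nonempty K(4)] by linarith
  ultimately show ?thesis by simp
qed

text \<open>For each \<phi> the cotangent varies by at most twice its width along the vertices,
  because each level strictly between the extremes is taken at most twice. Integration with the
  Crofton formula puts the factor 4 on both sides.\<close>

lemma polygon_le:
  assumes t: "t 0 = 0" "t n = 1" "\<And>i. i < n \<Longrightarrow> t i \<le> t (Suc i)"
  shows "(\<Sum>i<n. hdist (\<gamma> (t i)) (\<gamma> (t (Suc i)))) \<le> integral {0..2*pi} (kmax K)"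
proof -
  have "(\<Sum>i<n. \<bar>kcot (\<gamma> (t (Suc i))) \<phi> - kcot (\<gamma> (t i)) \<phi>\<bar>) \<le> 2 * (kmax K \<phi> - kmin K \<phi>)" for \<phi>
  proof (rule sum_abs_diff_le_level_count[where F = "\<lambda>s. kcot (\<gamma> s) \<phi>", OF _ t])
    show "continuous_on {0..1} (\<lambda>s. kcot (\<gamma> s) \<phi>)"
      by (rule continuous_on_compose2[OF continuous_on_kcot_fst[OF K(4)] continuous_path])
        (use path_in in auto)
    show "kmin K \<phi> \<le> kcot (\<gamma> s) \<phi> \<and> kcot (\<gamma> s) \<phi> \<le> kmax K \<phi>" if "s \<in> {0..1}" for s
      using kmax_attained(2) kmin_attained(2) K K_nonempty path_in(2)[OF that] by blast
    fix u assume u: "kmin K \<phi> < u" "u < kmax K \<phi>"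
    let ?S = "{s \<in> {0..<1}. kcot (\<gamma> s) \<phi> = u}" and ?X = "{X \<in> frontier K. kcot X \<phi> = u}"
    have X: "finite ?X" "card ?X \<le> 2" using kcot_frontier_card[OF K u] by auto
    \<comment> \<open>A simple closed path identifies only the parameters 0 and 1, and 1 is excluded
      from \<open>?S\<close>.\<close>
    have inj: "inj_on \<gamma> ?S"
    proof (rule inj_onI)
      fix x y assume "x \<in> ?S" "y \<in> ?S" "\<gamma> x = \<gamma> y"
      moreover from this have "x = y \<or> x = 0 \<and> y = 1 \<or> x = 1 \<and> y = 0"
        using \<gamma>(1) unfolding simple_path_def loop_free_def
        by (metis (mono_tags, lifting) atLeastAtMost_iff atLeastLessThan_iff less_imp_le mem_Collect_eq)
      ultimately show "x = y" by auto
    qed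
    have sub: "\<gamma> ` ?S \<subseteq> ?X" using path_in(1) by auto
    show "finite ?S \<and> card ?S \<le> 2"
      using inj_on_finite[OF inj sub X(1)] order_trans[OF card_inj_on_le[OF inj sub X(1)] X(2)] ..
  qed
  note below = this
  have "4 * (\<Sum>i<n. hdist (\<gamma> (t i)) (\<gamma> (t (Suc i)))) \<le> 2 * (2 * integral {0..2*pi} (kmax K))"
    by (rule has_integral_le[OF polygon_has_integral[OF partition_mem[OF t]]
        has_integral_mult_right[OF width_has_integral] below])
  then show ?thesis by simp
qed

text \<open>For a fine uniform partition every boundary point has a vertex whose cotangent is within
  \<open>e\<close> for all \<phi> at once. Vertices thus come within \<open>e\<close> of both
  extremes, and the closed polygon has variation at least twice the width minus
  \<open>4 * e\<close>. Integrating over the period and dividing by 4 gives the error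
  \<open>2 * pi * e\<close>.\<close>

lemma polygon_ge:
  assumes "0 < e"
  obtains t n where "t 0 = 0" "t n = 1" "\<And>i. i < n \<Longrightarrow> t i \<le> t (Suc i)"
    "integral {0..2*pi} (kmax K) \<le> (\<Sum>i<n. hdist (\<gamma> (t i)) (\<gamma> (t (Suc i)))) + 2 * pi * e"
proof -
  obtain r where r: "0 \<le> r" "r < 1" "\<And>X. X \<in> K \<Longrightarrow> cmod X \<le> r"
    using compact_kdisk_radius[OF K(1) K_nonempty K(4)] by blast
  obtain d where d: "0 < d" "\<And>X Y \<phi> \<theta>. cmod X \<le> r \<Longrightarrow> cmod Y \<le> r \<Longrightarrow> dist X Y < d \<Longrightarrow>
        \<bar>\<phi> - \<theta>\<bar> < d \<Longrightarrow> \<bar>kcot X \<phi> - kcot Y \<theta>\<bar> < e"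
    using kcot_uniformly_continuous[OF r(2) assms] by blast
  have "uniformly_continuous_on {0..1} \<gamma>"
    using continuous_path by (rule compact_uniformly_continuous) simp
  then obtain h where h: "0 < h" "\<And>s s'. s \<in> {0..1} \<Longrightarrow> s' \<in> {0..1} \<Longrightarrow> dist s' s < h \<Longrightarrow> dist (\<gamma> s') (\<gamma> s) < d"
    unfolding uniformly_continuous_on_def using d(1) by metis
  obtain n where n: "n \<noteq> 0" "inverse (real n) < h" 
    using real_arch_inverse[of h] h(1) by auto
  define t where "t = (\<lambda>i. real i / real n)"
  have t: "t 0 = 0" "t n = 1" "\<And>i. i < n \<Longrightarrow> t i \<le> t (Suc i)"
    using n(1) by (auto simp: t_def divide_right_mono)
  have mem: "t i \<in> {0..1}" if "i \<le> n" for i using partition_mem[OF t that] .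
  have near: "\<exists>i\<le>n. \<forall>\<phi>. \<bar>kcot X \<phi> - kcot (\<gamma> (t i)) \<phi>\<bar> < e" if X: "X \<in> frontier K" for X
  proof -
    obtain s where s: "s \<in> {0..1}" "X = \<gamma> s" using X \<gamma>(3) unfolding path_image_def by blast
    \<comment> \<open>The last vertex at or before \<open>s\<close>, at parameter distance less than
      \<open>1 / n\<close>; for \<open>s = 1\<close> it is the vertex \<open>n\<close>
      itself.\<close>
    define i where "i = nat \<lfloor>s * n\<rfloor>"
    have fl: "real i \<le> s * n" "s * n < real i + 1" using s(1) by (auto simp: i_def)
    have "real i \<le> real n" using fl(1) mult_right_mono[of s 1 "real n"] s(1) by simp
    then have i: "i \<le> n" by simp
    have "\<bar>s - t i\<bar> < h"
    proof -
      have "0 \<le> s - t i" "s - t i < inverse (real n)"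
        using fl n(1) add_divide_distrib[of "real i" 1 "real n"]
        by (auto simp: t_def pos_divide_le_eq pos_less_divide_eq inverse_eq_divide diff_less_eq add.commute
          simp flip: add_divide_distrib)
      then show ?thesis using n(2) by linarith
    qed
    then have "dist (\<gamma> s) (\<gamma> (t i)) < d"
      using h(2)[OF mem[OF i] s(1)] by (simp add: dist_real_def)
    then show ?thesis
      using d s r(3) path_in(2) mem[OF i] i by (intro exI[of _ i]) (auto intro!: d(2))
  qed
  have "2 * (kmax K \<phi> - kmin K \<phi>) - 4 * e \<le> (\<Sum>i<n. \<bar>kcot (\<gamma> (t (Suc i))) \<phi> - kcot (\<gamma> (t i)) \<phi>\<bar>)" for \<phi>
  proof -
    obtain X Y where XY: "X \<in> frontier K" "kcot X \<phi> = kmax K \<phi>" "Y \<in> frontier K" "kcot Y \<phi> = kmin K \<phi>"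
      using kmax_kmin_frontier[OF K(1) K_nonempty K(4)] by metis
    obtain j where j: "j \<le> n" "\<bar>kmax K \<phi> - kcot (\<gamma> (t j)) \<phi>\<bar> < e" using near[OF XY(1)] XY(2) by metis
    obtain k where k: "k \<le> n" "\<bar>kmin K \<phi> - kcot (\<gamma> (t k)) \<phi>\<bar> < e" using near[OF XY(3)] XY(4) by metis
    have "\<gamma> (t n) = \<gamma> (t 0)" using \<gamma>(2) t by (simp add: pathfinish_def pathstart_def)
    then have "2 * (kcot (\<gamma> (t j)) \<phi> - kcot (\<gamma> (t k)) \<phi>)
        \<le> (\<Sum>i<n. \<bar>kcot (\<gamma> (t (Suc i))) \<phi> - kcot (\<gamma> (t i)) \<phi>\<bar>)"
      using j(1) k(1) by (intro closed_variation_ge[of "\<lambda>i. kcot (\<gamma> (t i)) \<phi>"]) auto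
    moreover have "2 * (kmax K \<phi> - kmin K \<phi>) - 4 * e \<le> 2 * (kcot (\<gamma> (t j)) \<phi> - kcot (\<gamma> (t k)) \<phi>)"
      using j(2) k(2) unfolding abs_less_iff by argo
    ultimately show ?thesis by (rule order_trans[rotated])
  qed
  note below = this
  have int: "((\<lambda>\<phi>. 2 * (kmax K \<phi> - kmin K \<phi>) - 4 * e) has_integral
      2 * (2 * integral {0..2*pi} (kmax K)) - 2 * pi * (4 * e)) {0..2*pi}"
    using has_integral_const_real[of "4 * e" 0 "2 * pi"]
    by (intro has_integral_diff has_integral_mult_right width_has_integral) simp
  have "2 * (2 * integral {0..2*pi} (kmax K)) - 2 * pi * (4 * e)
      \<le> 4 * (\<Sum>i<n. hdist (\<gamma> (t i)) (\<gamma> (t (Suc i))))"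
    by (rule has_integral_le[OF int polygon_has_integral[OF mem] below])
  then have "integral {0..2*pi} (kmax K) \<le> (\<Sum>i<n. hdist (\<gamma> (t i)) (\<gamma> (t (Suc i)))) + 2 * pi * e"
    by simp
  with t show thesis by (rule that)
qed

lemma hyp_length_eq: "hyp_length \<gamma> = ereal (integral {0..2*pi} (kmax K))"
proof (rule antisym)
  show "hyp_length \<gamma> \<le> ereal (integral {0..2*pi} (kmax K))"
    unfolding hyp_length_def by (rule Sup_least) (auto intro!: polygon_le)
  show "ereal (integral {0..2*pi} (kmax K)) \<le> hyp_length \<gamma>"
  proof (rule ereal_le_epsilon2)
    fix e :: real assume "0 < e"
    \<comment> \<open>This tolerance makes the error \<open>2 * pi * (e / (2 * pi))\<close> equal to
      \<open>e\<close>.\<close>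
    then have "0 < e / (2 * pi)" by simp
    then show "ereal (integral {0..2*pi} (kmax K)) \<le> hyp_length \<gamma> + ereal e"
    proof (rule polygon_ge)
      fix t n assume t: "t 0 = 0" "t n = 1" "\<And>i. i < n \<Longrightarrow> t i \<le> t (Suc i)"
      and le: "integral {0..2*pi} (kmax K) \<le> (\<Sum>i<n. hdist (\<gamma> (t i)) (\<gamma> (t (Suc i)))) + 2 * pi * (e / (2 * pi))"
    have "ereal (integral {0..2*pi} (kmax K)) \<le> ereal (\<Sum>i<n. hdist (\<gamma> (t i)) (\<gamma> (t (Suc i)))) + ereal e"
      using le by simp
    also have "\<dots> \<le> hyp_length \<gamma> + ereal e"
      unfolding hyp_length_def using t by (intro add_right_mono Sup_upper) blast
    finally show "ereal (integral {0..2*pi} (kmax K)) \<le> hyp_length \<gamma> + ereal e" .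
    qed
  qed
qed

end

theorem theorem4p3:
  fixes K :: "complex set" and \<gamma> :: "real \<Rightarrow> complex"
  assumes "compact K" and "convex K" and "interior K \<noteq> {}" and "K \<subseteq> kdisk"
    and "simple_path \<gamma>" and "pathfinish \<gamma> = pathstart \<gamma>"
    and "path_image \<gamma> = frontier K"
  shows "\<exists>I. ((\<lambda>\<phi>. sinh (rsig K \<phi>)) has_integral I) {0..2*pi} \<and> hyp_length \<gamma> = ereal I"
proof -
  interpret klein_boundary K \<gamma> by unfold_locales (use assms in auto)
  have "(\<lambda>\<phi>. sinh (rsig K \<phi>)) = kmax K"
    by (rule ext) (simp add: sinh_rsig assms kmax_def)
  moreover have "(kmax K has_integral integral {0..2*pi} (kmax K)) {0..2*pi}"
    by (intro integrable_integral integrable_continuous_interval continuous_on_kmax_kmin K K_nonempty)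
  ultimately show ?thesis using hyp_length_eq by auto
qed

end
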